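(* Let $E$ be an f-BC which is an admissible union of a family of sub-f-BCs $\{E_\alpha\}_{\alpha\in I}$. Let $A$ be a subset of $\bigcap_{\alpha\in I}E_\alpha$ such that for each $\alpha\in I$, $A$ meets each connected component of $E_\alpha$. Then the groupoid $\Pi(E,A)$ is the direct limit of the groupoids $\Pi(E_\alpha,A)$.
   Context: Let $G=\langle g\rangle$ be a fixed infinite cyclic group. A fractional Brauer configuration (f-BC) is a quadruple $E=(E,P,L,d)$, where $E$ is a $G$-set, $P$ and $L$ are two partitions of $E$ (write $P(e)$, $L(e)$ for the classes containing $e\in E$), and $d:E\to\mathbb{Z}_{>0}$ is a function, such that: (f1) $L(e)\subseteq P(e)$ and $P(e)$ is a finite set for each $e\in E$; (f2) if $L(e_1)=L(e_2)$, then $P(g\cdot e_1)=P(g\cdot e_2)$; (f3) if $e_1,e_2$ belong to the same $G$-orbit, then $d(e_1)=d(e_2)$; (f4) $P(e_1)=P(e_2)$ if and only if $P(g^{d(e_1)}\cdot e_1)=P(g^{d(e_2)}\cdot e_2)$; (f5) $L(e_1)=L(e_2)$ if and only if $L(g^{d(e_1)}\cdot e_1)=L(g^{d(e_2)}\cdot e_2)$; (f6) the sequence $L(g^{d(e)-1}\cdot e)\cdots L(g\cdot e)L(e)$ is not a proper subsequence (block of consecutive terms) of $L(g^{d(h)-1}\cdot h)\cdots L(g\cdot h)L(h)$ for all $e,h\in E$. A morphism of f-BCs $f:(E,P,L,d)\to(E',P',L',d')$ is a $G$-equivariant map with $f(P(e))\subseteq P'(f(e))$, $f(L(e))\subseteq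 L'(f(e))$ and $d'(f(e))=d(e)$ for all $e$. Walks. A walk of $E$ is a sequence $w=(e_n|\delta_n|e_{n-1})\cdots(e_1|\delta_1|e_0)$ with $e_i\in E$, $\delta_i\in\{g,g^{-1},\tau\}$, such that $e_i=g\cdot e_{i-1}$ if $\delta_i=g$, $e_i=g^{-1}\cdot e_{i-1}$ if $\delta_i=g^{-1}$, $P(e_i)=P(e_{i-1})$ if $\delta_i=\tau$; abbreviated $(e_n|\delta_n\cdots\delta_1|e_0)$; $(e||e)$ is the trivial walk. Composition $uv$ is concatenation when the terminal of $v$ is the source of $u$. The connected components of $E$ are the classes of elements that can be connected by walks. Homotopy $\sim$ is the smallest equivalence relation on walks with: (h1) $(e|g^{-1}g|e)\sim(e|gg^{-1}|e)\sim(e|\tau|e)\sim(e||e)$; (h2) $(e_2|\tau|e_1)(e_1|\tau|e_0)\sim(e_2|\tau|e_0)$; (h3) $(g^{d(h)}\cdot h|\tau|g^{d(e)}\cdot e)(g^{d(e)}\cdot e|g^{d(e)}|e)\sim(g^{d(h)}\cdot h|g^{d(h)}|h)(h|\tau|e)$ whenever $P(e)=P(h)$; (h4) $(g\cdot h|\tau|g\cdot e)(g\cdot e|g|e)\sim(g\cdot h|g|h)(h|\tau|e)$ whenever $L(e)=L(h)$; (h5) compatibility with composition on both sides. For $A\subseteq E$, the fundamental groupoid $\Pi(E,A)$ has object set $A$, and $\Pi(E,A)(x,y)$ is the set of homotopy classes of walks of $E$ from $x$ to $y$, with composition induced by composition of walks. A morphism $f:E\to E'$ with $f(A)\subseteq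 A'$ induces a functor $f_*:\Pi(E,A)\to\Pi(E',A')$. A sub-f-BC $F$ of $E$ is a $G$-invariant subset of $E$ together with an f-BC structure such that the inclusion $F\hookrightarrow E$ is a morphism of f-BCs. For a family $\{E_\alpha=(E_\alpha,P_\alpha,L_\alpha,d)\}_{\alpha\in I}$ of sub-f-BCs of $E$: their union is $\bigcup_\alpha E_\alpha$ with $P'$ the partition into classes of the equivalence relation generated by $e\sim h$ whenever $e,h\in E_\alpha$ and $P_\alpha(e)=P_\alpha(h)$ for some $\alpha$, and $L'$ defined in the same way from the $L_\alpha$ (and degree function $d$); their intersection is $\bigcap_\alpha E_\alpha$ with $P''(e)=\bigcap_\alpha P_\alpha(e)$ and $L''(e)=\bigcap_\alpha L_\alpha(e)$. A simplicial complex $K$ on a finite set $X$ is a collection of nonempty subsets of $X$ (simplices) containing all singletons $\{x\}$ and closed under taking nonempty subsets. A walk of $K$ is a sequence $(x_0,\ldots,x_n)$ ($n\ge0$) of elements of $X$ such that $x_{i-1},x_i$ lie in a common simplex for each $1\le i\le n$. Homotopy of walks of $K$ is the equivalence relation, compatible with composition, generated by: $(x_0,x_1,x_2)$ is homotopic to $(x_0,x_2)$ if $x_0,x_1,x_2$ lie in a common simplex; $(x,x)$ is homotopic to $(x)$. $K$ is simply connected if any two elements of $X$ are connected by a walk and the group of homotopy classes of closed walks at a point is trivial. $E=(E,P,L,d)$ is an admissible union of sub-f-BCs $\{E_\alpha=(E_\alpha,P_\alpha,L_\alpha,d)\}_{\alpha\in I}$ if $E$ is (as an f-BC) the union of the family,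 the family is closed under finite intersections, and for each $e\in E$ the simplicial complex $K_e$ on $P(e)$ consisting of the sets $P_\alpha(h)$ ($\alpha\in I$, $h\in P(e)\cap E_\alpha$) and all their nonempty subsets is simply connected. The direct limit is taken in the category of groupoids, over the functors $j_{\beta\alpha*}:\Pi(E_\alpha,A)\to\Pi(E_\beta,A)$ for all $\alpha,\beta\in I$ with $E_\alpha$ a sub-f-BC of $E_\beta$ ($j_{\beta\alpha}$ the inclusion), with structural functors $j_{\alpha*}:\Pi(E_\alpha,A)\to\Pi(E,A)$ induced by the inclusions $j_\alpha:E_\alpha\to E$. Explicitly: for every groupoid $\mathscr{G}$ and functors $F_\alpha:\Pi(E_\alpha,A)\to\mathscr{G}$ with $F_\alpha=F_\beta j_{\beta\alpha*}$ for all such $\alpha,\beta$, there is a unique functor $F:\Pi(E,A)\to\mathscr{G}$ with $F_\alpha=Fj_{\alpha*}$ for all $\alpha\in I$. *)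

theory Defs
  imports
    "HOL-Algebra.Group_Action"
    "HOL-Algebra.Generated_Groups"
    "HOL-Library.Disjoint_Sets"
    "HOL-Library.Sublist"
begin

section \<open>Fractional Brauer configurations\<close>

definition infinite_cyclic :: "'g monoid \<Rightarrow> 'g \<Rightarrow> bool" where
  "infinite_cyclic G g \<longleftrightarrow>
     group G \<and> g \<in> carrier G \<and> generate G {g} = carrier G \<and> infinite (carrier G)"

record ('g, 'e) fbc_data =
  Elems :: "'e set"
  Act   :: "'g \<Rightarrow> 'e \<Rightarrow> 'e"
  PPart :: "'e set set"
  LPart :: "'e set set"
  Deg   :: "'e \<Rightarrow> nat"

definition block :: "'e set set \<Rightarrow> 'e \<Rightarrow> 'e set" where
  "block Q e = (THE X. X \<in> Q \<and> e \<in> X)"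

abbreviation Pcl :: "('g, 'e) fbc_data \<Rightarrow> 'e \<Rightarrow> 'e set" where
  "Pcl E e \<equiv> block (PPart E) e"

abbreviation Lcl :: "('g, 'e) fbc_data \<Rightarrow> 'e \<Rightarrow> 'e set" where
  "Lcl E e \<equiv> block (LPart E) e"

abbreviation gpow :: "'g monoid \<Rightarrow> 'g \<Rightarrow> ('g, 'e) fbc_data \<Rightarrow> nat \<Rightarrow> 'e \<Rightarrow> 'e" where
  "gpow G g E n e \<equiv> Act E (g [^]\<^bsub>G\<^esub> n) e"

text \<open>The sequence \<open>L(g\<^sup>d\<^sup>-\<^sup>1 e) \<dots> L(g e) L(e)\<close> with \<open>d = d(e)\<close>.\<close>

definition Lseq :: "'g monoid \<Rightarrow> 'g \<Rightarrow> ('g, 'e) fbc_data \<Rightarrow> 'e \<Rightarrow> 'e set list" where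
  "Lseq G g E e = map (\<lambda>i. Lcl E (gpow G g E i e)) (rev [0..<Deg E e])"

text \<open>
  In \<^const>\<open>group_action\<close>, each group element acts by a function that is
  extensional outside \<open>Elems E\<close>.
\<close>

definition fbc :: "'g monoid \<Rightarrow> 'g \<Rightarrow> ('g, 'e) fbc_data \<Rightarrow> bool" where
  "fbc G g E \<longleftrightarrow>
     group_action G (Elems E) (Act E) \<and>
     partition_on (Elems E) (PPart E) \<and>
     partition_on (Elems E) (LPart E) \<and>
     (\<forall>e\<in>Elems E. Deg E e > 0) \<and>
     (\<forall>e\<in>Elems E. Lcl E e \<subseteq> Pcl E e \<and> finite (Pcl E e)) \<and>
     (\<forall>e1\<in>Elems E. \<forall>e2\<in>Elems E.
        Lcl E e1 = Lcl E e2 \<longrightarrow> Pcl E (Act E g e1) = Pcl E (Act E g e2)) \<and>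
     (\<forall>e1\<in>Elems E. \<forall>e2\<in>Elems E.
        e2 \<in> orbit G (Act E) e1 \<longrightarrow> Deg E e1 = Deg E e2) \<and>
     (\<forall>e1\<in>Elems E. \<forall>e2\<in>Elems E.
        Pcl E e1 = Pcl E e2 \<longleftrightarrow>
        Pcl E (gpow G g E (Deg E e1) e1) = Pcl E (gpow G g E (Deg E e2) e2)) \<and>
     (\<forall>e1\<in>Elems E. \<forall>e2\<in>Elems E.
        Lcl E e1 = Lcl E e2 \<longleftrightarrow>
        Lcl E (gpow G g E (Deg E e1) e1) = Lcl E (gpow G g E (Deg E e2) e2)) \<and>
     (\<forall>e\<in>Elems E. \<forall>h\<in>Elems E. \<not> strict_sublist (Lseq G g E e) (Lseq G g E h))"

definition fbc_morphism ::
  "'g monoid \<Rightarrow> ('g, 'e) fbc_data \<Rightarrow> ('g, 'f) fbc_data \<Rightarrow> ('e \<Rightarrow> 'f) \<Rightarrow> bool" where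
  "fbc_morphism G E E' f \<longleftrightarrow>
     f ` Elems E \<subseteq> Elems E' \<and>
     (\<forall>x\<in>carrier G. \<forall>e\<in>Elems E. f (Act E x e) = Act E' x (f e)) \<and>
     (\<forall>e\<in>Elems E. f ` Pcl E e \<subseteq> Pcl E' (f e)) \<and>
     (\<forall>e\<in>Elems E. f ` Lcl E e \<subseteq> Lcl E' (f e)) \<and>
     (\<forall>e\<in>Elems E. Deg E' (f e) = Deg E e)"

text \<open>Equivariance of the inclusion makes \<open>Elems F\<close> a \<open>G\<close>-invariant subset.\<close>

definition sub_fbc :: "'g monoid \<Rightarrow> 'g \<Rightarrow> ('g, 'e) fbc_data \<Rightarrow> ('g, 'e) fbc_data \<Rightarrow> bool" where
  "sub_fbc G g F E \<longleftrightarrow> Elems F \<subseteq> Elems E \<and> fbc G g F \<and> fbc_morphism G F E (\<lambda>e. e)"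

text \<open>
  Equality of f-BCs, ignoring the values of the action and the degree function at
  arguments where they have no meaning.
\<close>

definition fbc_eq :: "'g monoid \<Rightarrow> ('g, 'e) fbc_data \<Rightarrow> ('g, 'e) fbc_data \<Rightarrow> bool" where
  "fbc_eq G E F \<longleftrightarrow>
     Elems E = Elems F \<and>
     (\<forall>x\<in>carrier G. \<forall>e\<in>Elems E. Act E x e = Act F x e) \<and>
     PPart E = PPart F \<and> LPart E = LPart F \<and>
     (\<forall>e\<in>Elems E. Deg E e = Deg F e)"

text \<open>
  Given partitions \<open>Q \<alpha>\<close> of the sets \<open>X \<alpha>\<close>: the classes of the equivalence relation on
  their union generated by all the \<open>Q \<alpha>\<close>, and the partition of their intersection
  with classes \<open>\<Inter>\<^sub>\<alpha> Q\<^sub>\<alpha>(e)\<close>.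
\<close>

definition union_partition :: "'i set \<Rightarrow> ('i \<Rightarrow> 'e set) \<Rightarrow> ('i \<Rightarrow> 'e set set) \<Rightarrow> 'e set set" where
  "union_partition I X Q =
     (\<Union>\<alpha>\<in>I. X \<alpha>) //
     {(e, h). equivclp (\<lambda>e h. \<exists>\<alpha>\<in>I. e \<in> X \<alpha> \<and> h \<in> X \<alpha> \<and> block (Q \<alpha>) e = block (Q \<alpha>) h) e h}"

definition inter_partition :: "'i set \<Rightarrow> ('i \<Rightarrow> 'e set) \<Rightarrow> ('i \<Rightarrow> 'e set set) \<Rightarrow> 'e set set" where
  "inter_partition I X Q = (\<lambda>e. \<Inter>\<alpha>\<in>I. block (Q \<alpha>) e) ` (\<Inter>\<alpha>\<in>I. X \<alpha>)"

text \<open>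
  Union and intersection of a family of sub-f-BCs of \<open>E\<close>; action and degree are those
  of \<open>E\<close>. The intersection is only meant for nonempty index sets.
\<close>

definition fbc_union ::
  "('g, 'e) fbc_data \<Rightarrow> 'i set \<Rightarrow> ('i \<Rightarrow> ('g, 'e) fbc_data) \<Rightarrow> ('g, 'e) fbc_data" where
  "fbc_union E I F =
     \<lparr> Elems = (\<Union>\<alpha>\<in>I. Elems (F \<alpha>)),
       Act = (\<lambda>x. restrict (Act E x) (\<Union>\<alpha>\<in>I. Elems (F \<alpha>))),
       PPart = union_partition I (\<lambda>\<alpha>. Elems (F \<alpha>)) (\<lambda>\<alpha>. PPart (F \<alpha>)),
       LPart = union_partition I (\<lambda>\<alpha>. Elems (F \<alpha>)) (\<lambda>\<alpha>. LPart (F \<alpha>)),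
       Deg = Deg E \<rparr>"

definition fbc_inter ::
  "('g, 'e) fbc_data \<Rightarrow> 'i set \<Rightarrow> ('i \<Rightarrow> ('g, 'e) fbc_data) \<Rightarrow> ('g, 'e) fbc_data" where
  "fbc_inter E I F =
     \<lparr> Elems = (\<Inter>\<alpha>\<in>I. Elems (F \<alpha>)),
       Act = (\<lambda>x. restrict (Act E x) (\<Inter>\<alpha>\<in>I. Elems (F \<alpha>))),
       PPart = inter_partition I (\<lambda>\<alpha>. Elems (F \<alpha>)) (\<lambda>\<alpha>. PPart (F \<alpha>)),
       LPart = inter_partition I (\<lambda>\<alpha>. Elems (F \<alpha>)) (\<lambda>\<alpha>. LPart (F \<alpha>)),
       Deg = Deg E \<rparr>"


section \<open>Walks and homotopy\<close>

datatype letter = Gen | GenInv | Tau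

text \<open>
  \<open>Triv e\<close> is \<open>(e||e)\<close> and \<open>Step e \<delta> w\<close> is \<open>(e|\<delta>|t) w\<close> with \<open>t\<close> the terminal of \<open>w\<close>,
  so walks are read from right to left.
\<close>

datatype 'e walk = Triv 'e | Step 'e letter "'e walk"

fun source :: "'e walk \<Rightarrow> 'e" where
  "source (Triv e) = e"
| "source (Step e \<delta> w) = source w"

fun terminal :: "'e walk \<Rightarrow> 'e" where
  "terminal (Triv e) = e"
| "terminal (Step e \<delta> w) = e"

text \<open>\<open>wcomp u v\<close> is the composite \<open>uv\<close>, first \<open>v\<close> and then \<open>u\<close>.\<close>

fun wcomp :: "'e walk \<Rightarrow> 'e walk \<Rightarrow> 'e walk" where
  "wcomp (Triv e) v = v"
| "wcomp (Step e \<delta> u) v = Step e \<delta> (wcomp u v)"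

fun is_step :: "'g monoid \<Rightarrow> 'g \<Rightarrow> ('g, 'e) fbc_data \<Rightarrow> 'e \<Rightarrow> letter \<Rightarrow> 'e \<Rightarrow> bool" where
  "is_step G g E e' Gen e \<longleftrightarrow> e' = Act E g e"
| "is_step G g E e' GenInv e \<longleftrightarrow> e' = Act E (inv\<^bsub>G\<^esub> g) e"
| "is_step G g E e' Tau e \<longleftrightarrow> Pcl E e' = Pcl E e"

fun is_walk :: "'g monoid \<Rightarrow> 'g \<Rightarrow> ('g, 'e) fbc_data \<Rightarrow> 'e walk \<Rightarrow> bool" where
  "is_walk G g E (Triv e) \<longleftrightarrow> e \<in> Elems E"
| "is_walk G g E (Step e \<delta> w) \<longleftrightarrow>
     e \<in> Elems E \<and> is_walk G g E w \<and> is_step G g E e \<delta> (terminal w)"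

text \<open>The walk \<open>(e'|\<delta>|e)\<close> of length one, and the walk \<open>(g\<^sup>n e|g\<^sup>n|e)\<close>.\<close>

abbreviation edge :: "'e \<Rightarrow> letter \<Rightarrow> 'e \<Rightarrow> 'e walk" where
  "edge e' \<delta> e \<equiv> Step e' \<delta> (Triv e)"

fun gwalk :: "'g monoid \<Rightarrow> 'g \<Rightarrow> ('g, 'e) fbc_data \<Rightarrow> nat \<Rightarrow> 'e \<Rightarrow> 'e walk" where
  "gwalk G g E 0 e = Triv e"
| "gwalk G g E (Suc n) e = Step (gpow G g E (Suc n) e) Gen (gwalk G g E n e)"

inductive homotopic :: "'g monoid \<Rightarrow> 'g \<Rightarrow> ('g, 'e) fbc_data \<Rightarrow> 'e walk \<Rightarrow> 'e walk \<Rightarrow> bool"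
  for G g E where
  refl: "is_walk G g E w \<Longrightarrow> homotopic G g E w w"
| sym: "homotopic G g E v w \<Longrightarrow> homotopic G g E w v"
| trans: "homotopic G g E u v \<Longrightarrow> homotopic G g E v w \<Longrightarrow> homotopic G g E u w"
| h1_inv_gen: "e \<in> Elems E \<Longrightarrow>
    homotopic G g E (wcomp (edge e GenInv (Act E g e)) (edge (Act E g e) Gen e)) (Triv e)"
| h1_gen_inv: "e \<in> Elems E \<Longrightarrow>
    homotopic G g E
      (wcomp (edge e Gen (Act E (inv\<^bsub>G\<^esub> g) e)) (edge (Act E (inv\<^bsub>G\<^esub> g) e) GenInv e)) (Triv e)"
| h1_tau: "e \<in> Elems E \<Longrightarrow> homotopic G g E (edge e Tau e) (Triv e)"
| h2: "\<lbrakk> e0 \<in> Elems E; e1 \<in> Elems E; e2 \<in> Elems E; Pcl E e1 = Pcl E e0; Pcl E e2 = Pcl E e1 \<rbrakk> \<Longrightarrow>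
    homotopic G g E (wcomp (edge e2 Tau e1) (edge e1 Tau e0)) (edge e2 Tau e0)"
| h3: "\<lbrakk> e \<in> Elems E; h \<in> Elems E; Pcl E e = Pcl E h \<rbrakk> \<Longrightarrow>
    homotopic G g E
      (wcomp (edge (gpow G g E (Deg E h) h) Tau (gpow G g E (Deg E e) e)) (gwalk G g E (Deg E e) e))
      (wcomp (gwalk G g E (Deg E h) h) (edge h Tau e))"
| h4: "\<lbrakk> e \<in> Elems E; h \<in> Elems E; Lcl E e = Lcl E h \<rbrakk> \<Longrightarrow>
    homotopic G g E
      (wcomp (edge (Act E g h) Tau (Act E g e)) (edge (Act E g e) Gen e))
      (wcomp (edge (Act E g h) Gen h) (edge h Tau e))"
| h5_left: "\<lbrakk> homotopic G g E v w; is_walk G g E u; source u = terminal v \<rbrakk> \<Longrightarrow>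
    homotopic G g E (wcomp u v) (wcomp u w)"
| h5_right: "\<lbrakk> homotopic G g E v w; is_walk G g E u; terminal u = source v \<rbrakk> \<Longrightarrow>
    homotopic G g E (wcomp v u) (wcomp w u)"

definition hclass :: "'g monoid \<Rightarrow> 'g \<Rightarrow> ('g, 'e) fbc_data \<Rightarrow> 'e walk \<Rightarrow> 'e walk set" where
  "hclass G g E w = {w'. homotopic G g E w w'}"

definition connected_components :: "'g monoid \<Rightarrow> 'g \<Rightarrow> ('g, 'e) fbc_data \<Rightarrow> 'e set set" where
  "connected_components G g E =
     (\<lambda>e. {h. \<exists>w. is_walk G g E w \<and> source w = e \<and> terminal w = h}) ` Elems E"


section \<open>Groupoids\<close>

record ('o, 'm) gpd =
  Obj   :: "'o set"
  Arr   :: "'m set"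
  Dom   :: "'m \<Rightarrow> 'o"
  Cod   :: "'m \<Rightarrow> 'o"
  Ident :: "'o \<Rightarrow> 'm"
  Comp  :: "'m \<Rightarrow> 'm \<Rightarrow> 'm"

text \<open>\<open>Comp C a b\<close> is the composite \<open>a b\<close>, meaningful only if \<open>Dom C a = Cod C b\<close>.\<close>

definition groupoid :: "('o, 'm) gpd \<Rightarrow> bool" where
  "groupoid C \<longleftrightarrow>
     (\<forall>a\<in>Arr C. Dom C a \<in> Obj C \<and> Cod C a \<in> Obj C) \<and>
     (\<forall>x\<in>Obj C. Ident C x \<in> Arr C \<and> Dom C (Ident C x) = x \<and> Cod C (Ident C x) = x) \<and>
     (\<forall>a\<in>Arr C. \<forall>b\<in>Arr C. Dom C a = Cod C b \<longrightarrow>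
        Comp C a b \<in> Arr C \<and> Dom C (Comp C a b) = Dom C b \<and> Cod C (Comp C a b) = Cod C a) \<and>
     (\<forall>a\<in>Arr C. Comp C a (Ident C (Dom C a)) = a \<and> Comp C (Ident C (Cod C a)) a = a) \<and>
     (\<forall>a\<in>Arr C. \<forall>b\<in>Arr C. \<forall>c\<in>Arr C. Dom C a = Cod C b \<longrightarrow> Dom C b = Cod C c \<longrightarrow>
        Comp C (Comp C a b) c = Comp C a (Comp C b c)) \<and>
     (\<forall>a\<in>Arr C. \<exists>b\<in>Arr C. Dom C b = Cod C a \<and> Cod C b = Dom C a \<and>
        Comp C b a = Ident C (Dom C a) \<and> Comp C a b = Ident C (Cod C a))"

text \<open>A functor is a pair of an object map and an arrow map.\<close>

type_synonym ('o, 'm, 'p, 'n) functr = "('o \<Rightarrow> 'p) \<times> ('m \<Rightarrow> 'n)"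

definition is_functor :: "('o, 'm) gpd \<Rightarrow> ('p, 'n) gpd \<Rightarrow> ('o, 'm, 'p, 'n) functr \<Rightarrow> bool" where
  "is_functor C D \<Phi> \<longleftrightarrow>
     (\<forall>x\<in>Obj C. fst \<Phi> x \<in> Obj D) \<and>
     (\<forall>a\<in>Arr C. snd \<Phi> a \<in> Arr D \<and>
        Dom D (snd \<Phi> a) = fst \<Phi> (Dom C a) \<and> Cod D (snd \<Phi> a) = fst \<Phi> (Cod C a)) \<and>
     (\<forall>x\<in>Obj C. snd \<Phi> (Ident C x) = Ident D (fst \<Phi> x)) \<and>
     (\<forall>a\<in>Arr C. \<forall>b\<in>Arr C. Dom C a = Cod C b \<longrightarrow>
        snd \<Phi> (Comp C a b) = Comp D (snd \<Phi> a) (snd \<Phi> b))"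

definition functor_comp ::
  "('p, 'n, 'q, 'k) functr \<Rightarrow> ('o, 'm, 'p, 'n) functr \<Rightarrow> ('o, 'm, 'q, 'k) functr" where
  "functor_comp \<Psi> \<Phi> = (fst \<Psi> \<circ> fst \<Phi>, snd \<Psi> \<circ> snd \<Phi>)"

text \<open>Equality of functors with source \<open>C\<close>.\<close>

definition functor_eq ::
  "('o, 'm) gpd \<Rightarrow> ('o, 'm, 'p, 'n) functr \<Rightarrow> ('o, 'm, 'p, 'n) functr \<Rightarrow> bool" where
  "functor_eq C \<Phi> \<Psi> \<longleftrightarrow>
     (\<forall>x\<in>Obj C. fst \<Phi> x = fst \<Psi> x) \<and> (\<forall>a\<in>Arr C. snd \<Phi> a = snd \<Psi> a)"

text \<open>
  A cocone from the diagram with groupoids \<open>\<Gamma> \<alpha>\<close> (\<open>\<alpha> \<in> I\<close>) and functors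
  \<open>t \<beta> \<alpha> : \<Gamma> \<alpha> \<rightarrow> \<Gamma> \<beta>\<close> (for \<open>R \<alpha> \<beta>\<close>) to the groupoid \<open>H\<close>.
\<close>

definition is_cocone ::
  "'i set \<Rightarrow> ('i \<Rightarrow> 'i \<Rightarrow> bool) \<Rightarrow> ('i \<Rightarrow> ('o, 'm) gpd) \<Rightarrow> ('i \<Rightarrow> 'i \<Rightarrow> ('o, 'm, 'o, 'm) functr) \<Rightarrow>
   ('p, 'n) gpd \<Rightarrow> ('i \<Rightarrow> ('o, 'm, 'p, 'n) functr) \<Rightarrow> bool" where
  "is_cocone I R \<Gamma> t H F \<longleftrightarrow>
     (\<forall>\<alpha>\<in>I. is_functor (\<Gamma> \<alpha>) H (F \<alpha>)) \<and>
     (\<forall>\<alpha>\<in>I. \<forall>\<beta>\<in>I. R \<alpha> \<beta> \<longrightarrow> functor_eq (\<Gamma> \<alpha>) (F \<alpha>) (functor_comp (F \<beta>) (t \<beta> \<alpha>)))"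

text \<open>
  The groupoid \<open>\<Lambda>\<close> with structural functors \<open>s\<close> is the direct limit. Quantification over
  types is impossible inside a definition, so the first argument fixes the types of
  objects and arrows of the test groupoids; a theorem in which these are type
  variables covers all groupoids.
\<close>

definition is_direct_limit ::
  "('p, 'n) gpd itself \<Rightarrow> 'i set \<Rightarrow> ('i \<Rightarrow> 'i \<Rightarrow> bool) \<Rightarrow> ('i \<Rightarrow> ('o, 'm) gpd) \<Rightarrow>
   ('i \<Rightarrow> 'i \<Rightarrow> ('o, 'm, 'o, 'm) functr) \<Rightarrow>
   ('o, 'm) gpd \<Rightarrow> ('i \<Rightarrow> ('o, 'm, 'o, 'm) functr) \<Rightarrow> bool" where
  "is_direct_limit T I R \<Gamma> t \<Lambda> s \<longleftrightarrow>
     (\<forall>\<alpha>\<in>I. groupoid (\<Gamma> \<alpha>)) \<and>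
     (\<forall>\<alpha>\<in>I. \<forall>\<beta>\<in>I. R \<alpha> \<beta> \<longrightarrow> is_functor (\<Gamma> \<alpha>) (\<Gamma> \<beta>) (t \<beta> \<alpha>)) \<and>
     groupoid \<Lambda> \<and> is_cocone I R \<Gamma> t \<Lambda> s \<and>
     (\<forall>(H :: ('p, 'n) gpd) F. groupoid H \<and> is_cocone I R \<Gamma> t H F \<longrightarrow>
        (\<exists>\<Phi>. is_functor \<Lambda> H \<Phi> \<and>
             (\<forall>\<alpha>\<in>I. functor_eq (\<Gamma> \<alpha>) (F \<alpha>) (functor_comp \<Phi> (s \<alpha>))) \<and>
             (\<forall>\<Psi>. is_functor \<Lambda> H \<Psi> \<and>
                  (\<forall>\<alpha>\<in>I. functor_eq (\<Gamma> \<alpha>) (F \<alpha>) (functor_comp \<Psi> (s \<alpha>))) \<longrightarrow>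
                  functor_eq \<Lambda> \<Phi> \<Psi>)))"


section \<open>The fundamental groupoid\<close>

text \<open>
  Arrows are homotopy classes. All walks in a class have the same source and terminal,
  and the union in the composite ranges over equal classes.
\<close>

definition fundamental_groupoid ::
  "'g monoid \<Rightarrow> 'g \<Rightarrow> ('g, 'e) fbc_data \<Rightarrow> 'e set \<Rightarrow> ('e, 'e walk set) gpd" where
  "fundamental_groupoid G g E A =
     \<lparr> Obj = A,
       Arr = {hclass G g E w | w. is_walk G g E w \<and> source w \<in> A \<and> terminal w \<in> A},
       Dom = (\<lambda>c. the_elem (source ` c)),
       Cod = (\<lambda>c. the_elem (terminal ` c)),
       Ident = (\<lambda>x. hclass G g E (Triv x)),
       Comp = (\<lambda>c c'. \<Union>u\<in>c. \<Union>v\<in>c'. hclass G g E (wcomp u v)) \<rparr>"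

text \<open>The functor \<open>f\<^sub>*\<close> into a fundamental groupoid of \<open>E'\<close>, sending the class of \<open>w\<close> to that of \<open>f(w)\<close>.\<close>

definition induced_functor ::
  "'g monoid \<Rightarrow> 'g \<Rightarrow> ('g, 'f) fbc_data \<Rightarrow> ('e \<Rightarrow> 'f) \<Rightarrow>
   ('e, 'e walk set, 'f, 'f walk set) functr" where
  "induced_functor G g E' f = (f, \<lambda>c. \<Union>w\<in>c. hclass G g E' (map_walk f w))"


section \<open>Simplicial complexes\<close>

definition simplicial_complex :: "'x set \<Rightarrow> 'x set set \<Rightarrow> bool" where
  "simplicial_complex X K \<longleftrightarrow>
     finite X \<and> (\<forall>S\<in>K. S \<noteq> {} \<and> S \<subseteq> X) \<and> (\<forall>x\<in>X. {x} \<in> K) \<and>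
     (\<forall>S\<in>K. \<forall>T. T \<noteq> {} \<and> T \<subseteq> S \<longrightarrow> T \<in> K)"

definition simp_walk :: "'x set \<Rightarrow> 'x set set \<Rightarrow> 'x list \<Rightarrow> bool" where
  "simp_walk X K xs \<longleftrightarrow>
     xs \<noteq> [] \<and> set xs \<subseteq> X \<and> successively (\<lambda>x y. \<exists>S\<in>K. x \<in> S \<and> y \<in> S) xs"

text \<open>\<open>xs @ tl ys\<close> is the composite of walks with \<open>last xs = hd ys\<close>.\<close>

inductive simp_homotopic :: "'x set \<Rightarrow> 'x set set \<Rightarrow> 'x list \<Rightarrow> 'x list \<Rightarrow> bool"
  for X K where
  refl: "simp_walk X K xs \<Longrightarrow> simp_homotopic X K xs xs"
| sym: "simp_homotopic X K xs ys \<Longrightarrow> simp_homotopic X K ys xs"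
| trans: "simp_homotopic X K xs ys \<Longrightarrow> simp_homotopic X K ys zs \<Longrightarrow> simp_homotopic X K xs zs"
| triangle: "\<lbrakk> S \<in> K; x0 \<in> S; x1 \<in> S; x2 \<in> S \<rbrakk> \<Longrightarrow> simp_homotopic X K [x0, x1, x2] [x0, x2]"
| point: "x \<in> X \<Longrightarrow> simp_homotopic X K [x, x] [x]"
| comp: "\<lbrakk> simp_homotopic X K xs xs'; simp_homotopic X K ys ys'; last xs = hd ys \<rbrakk> \<Longrightarrow>
    simp_homotopic X K (xs @ tl ys) (xs' @ tl ys')"

text \<open>The underlying set of the group of homotopy classes of closed walks at \<open>x\<close>.\<close>

definition simp_pi1 :: "'x set \<Rightarrow> 'x set set \<Rightarrow> 'x \<Rightarrow> 'x list set set" where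
  "simp_pi1 X K x =
     {xs. simp_walk X K xs \<and> hd xs = x \<and> last xs = x} // {(xs, ys). simp_homotopic X K xs ys}"

definition simply_connected_complex :: "'x set \<Rightarrow> 'x set set \<Rightarrow> bool" where
  "simply_connected_complex X K \<longleftrightarrow>
     simplicial_complex X K \<and>
     (\<forall>x\<in>X. \<forall>y\<in>X. \<exists>xs. simp_walk X K xs \<and> hd xs = x \<and> last xs = y) \<and>
     (\<forall>x\<in>X. is_singleton (simp_pi1 X K x))"


section \<open>Admissible unions\<close>

definition local_complex ::
  "('g, 'e) fbc_data \<Rightarrow> 'i set \<Rightarrow> ('i \<Rightarrow> ('g, 'e) fbc_data) \<Rightarrow> 'e \<Rightarrow> 'e set set" where
  "local_complex E I F e =
     {S. S \<noteq> {} \<and> (\<exists>\<alpha>\<in>I. \<exists>h \<in> Pcl E e \<inter> Elems (F \<alpha>). S \<subseteq> Pcl (F \<alpha>) h)}"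

definition admissible_union ::
  "'g monoid \<Rightarrow> 'g \<Rightarrow> ('g, 'e) fbc_data \<Rightarrow> 'i set \<Rightarrow> ('i \<Rightarrow> ('g, 'e) fbc_data) \<Rightarrow> bool" where
  "admissible_union G g E I F \<longleftrightarrow>
     (\<forall>\<alpha>\<in>I. sub_fbc G g (F \<alpha>) E) \<and>
     fbc_eq G E (fbc_union E I F) \<and>
     (\<forall>J. J \<subseteq> I \<and> finite J \<and> J \<noteq> {} \<longrightarrow> (\<exists>\<gamma>\<in>I. fbc_eq G (F \<gamma>) (fbc_inter E J F))) \<and>
     (\<forall>e\<in>Elems E. simply_connected_complex (Pcl E e) (local_complex E I F e))"

end

theory Submission
  imports Defs
begin

text \<open>
  The argument is that of the Seifert-van Kampen theorem for groupoids. Let \<open>F\<^sub>\<alpha>\<close> be compatible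
  functors into a groupoid. Choose for every \<open>x\<close> a walk \<open>b\<^sub>x\<close> from \<open>A\<close> to \<open>x\<close> inside one member of
  the family. Closure under finite intersections allows one to compare \<open>b\<^sub>x\<close> with any walk of any
  \<open>E\<^sub>\<alpha>\<close> from \<open>A\<close> to \<open>x\<close>, through a walk lying in both members; this extends the \<open>F\<^sub>\<alpha>\<close> compatibly to
  all walks of the \<open>E\<^sub>\<alpha>\<close>. A \<open>\<tau>\<close>-step of \<open>E\<close> within a class \<open>P(e)\<close> gets the value of a walk in the
  complex \<open>K\<^sub>e\<close>, whose edges are the \<open>\<tau>\<close>-steps of the \<open>E\<^sub>\<alpha>\<close>; simple connectedness of \<open>K\<^sub>e\<close> makes
  this well defined. Relations (h3) and (h4) hold along such chains because they hold in each \<open>E\<^sub>\<alpha>\<close>.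
\<close>

section \<open>Blocks of partitions\<close>

text \<open>The values must be extended beyond \<open>A\<close> because a walk of \<open>E\<close>
  may pass from one member to another at points outside \<open>A\<close>, where the given functors
  say nothing. They are treated as functions on walks: one walk can lie in several members, while
  its homotopy classes there are different sets.

  In K_e, an edge is a \<tau>-step of a single member, and a triangle is an instance of (h2) inside
  a single member. Hence a homotopy of edge paths is a sequence of relations already valid in
  members, and this is how a condition on complexes controls the groupoids.

  Relation (h4) needs chains of another kind, whose neighbours share an L-class of a member. They
  come from the definition of L on a union as a generated equivalence. Simple connectedness then
  identifies the value along such a chain with the value of the \<tau>-step, which is defined by an
  arbitrary chain.

  Uniqueness of the functor is a separate matter: a walk of \<open>E\<close> between points of
  \<open>A\<close> is cut into pieces lying in members, and at every cut a detour to
  \<open>A\<close> is inserted. Each piece then has both ends in \<open>A\<close>, where the cocone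
  fixes its image.\<close>

lemma block_unique:
  assumes "partition_on X Q" "B \<in> Q" "e \<in> B"
  shows "block Q e = B"
  unfolding block_def
proof (rule the_equality)
  show "B \<in> Q \<and> e \<in> B" using assms by simp
  show "C = B" if "C \<in> Q \<and> e \<in> C" for C
    using assms that partition_onD2[OF assms(1)] by (auto dest: disjointD)
qed

lemma block_mem:
  assumes "partition_on X Q" "e \<in> X"
  shows "block Q e \<in> Q" "e \<in> block Q e" "block Q e \<subseteq> X"
proof -
  obtain B where B: "B \<in> Q" "e \<in> B"
    using assms partition_onD1 by fastforce
  then have "block Q e = B" using block_unique[OF assms(1)] by simp
  then show "block Q e \<in> Q" "e \<in> block Q e" "block Q e \<subseteq> X"
    using B partition_onD1[OF assms(1)] by auto
qed

lemma block_eqI: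
  assumes "partition_on X Q" "e \<in> X" "h \<in> block Q e"
  shows "block Q h = block Q e"
  using assms block_mem block_unique by metis

lemma block_eq_iff:
  assumes "partition_on X Q" "e \<in> X" "h \<in> X"
  shows "block Q h = block Q e \<longleftrightarrow> h \<in> block Q e"
  using assms block_mem block_eqI by metis


section \<open>Walks\<close>

fun flip :: "letter \<Rightarrow> letter" where
  "flip Gen = GenInv"
| "flip GenInv = Gen"
| "flip Tau = Tau"

fun winv :: "'e walk \<Rightarrow> 'e walk" where
  "winv (Triv e) = Triv e"
| "winv (Step e \<delta> w) = wcomp (winv w) (edge (terminal w) (flip \<delta>) e)"

lemma wcomp_assoc [simp]: "wcomp (wcomp u v) w = wcomp u (wcomp v w)"
  by (induction u) auto

lemma source_wcomp [simp]: "source (wcomp u v) = source v"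
  by (induction u) auto

lemma terminal_wcomp [simp]: "source u = terminal v \<Longrightarrow> terminal (wcomp u v) = terminal u"
  by (cases u) auto

lemma wcomp_Triv [simp]: "source u = x \<Longrightarrow> wcomp u (Triv x) = u"
  by (induction u) auto

lemma source_winv [simp]: "source (winv w) = terminal w"
  by (cases w) auto

lemma terminal_winv [simp]: "terminal (winv w) = source w"
  by (induction w) auto

lemma is_walk_wcomp [simp]:
  "source u = terminal v \<Longrightarrow> is_walk G g E (wcomp u v) \<longleftrightarrow> is_walk G g E u \<and> is_walk G g E v"
proof (induction u)
  case (Triv x)
  then show ?case by (cases v) auto
qed auto

lemma walk_Elems:
  assumes "is_walk G g E w"
  shows "source w \<in> Elems E" "terminal w \<in> Elems E"
  using assms by (induction w) auto

lemma source_gwalk [simp]: "source (gwalk G g E n e) = e"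
  by (induction n) auto


section \<open>Homotopy of walks\<close>

locale frac_brauer =
  fixes G :: "'g monoid" and g :: 'g and E :: "('g, 'e) fbc_data"
  assumes group_G: "group G" and g_carrier: "g \<in> carrier G" and is_fbc: "fbc G g E"
begin

sublocale act: group_action G "Elems E" "Act E"
  using is_fbc by (simp add: fbc_def)

lemma partP: "partition_on (Elems E) (PPart E)"
  and partL: "partition_on (Elems E) (LPart E)"
  using is_fbc by (auto simp: fbc_def)

lemmas g_facts [simp] = g_carrier group.inv_closed[OF group_G g_carrier]
  monoid.nat_pow_closed[OF group.is_monoid[OF group_G] g_carrier]

lemma act_closed [simp]: "x \<in> carrier G \<Longrightarrow> e \<in> Elems E \<Longrightarrow> Act E x e \<in> Elems E"
  using act.element_image by blast

lemma act_inv [simp]: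
  assumes "e \<in> Elems E"
  shows "Act E (inv\<^bsub>G\<^esub> g) (Act E g e) = e" "Act E g (Act E (inv\<^bsub>G\<^esub> g) e) = e"
proof -
  show "Act E (inv\<^bsub>G\<^esub> g) (Act E g e) = e"
    using act.orbit_sym_aux[OF g_carrier assms] by simp
  show "Act E g (Act E (inv\<^bsub>G\<^esub> g) e) = e"
    using act.orbit_sym_aux[OF _ assms, of "inv\<^bsub>G\<^esub> g"] group.inv_inv[OF group_G g_carrier] by simp
qed

lemma gpow_0 [simp]: "e \<in> Elems E \<Longrightarrow> Act E \<one>\<^bsub>G\<^esub> e = e"
  using act.id_eq_one by (metis restrict_apply')

lemma gpow_Suc: "e \<in> Elems E \<Longrightarrow> gpow G g E (Suc n) e = Act E g (gpow G g E n e)"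
  by (metis act.composition_rule g_facts(1,3) group.is_monoid group_G monoid.nat_pow_Suc2)

lemma Pcl_Elems: "e \<in> Elems E \<Longrightarrow> e \<in> Pcl E e" "e \<in> Elems E \<Longrightarrow> Pcl E e \<subseteq> Elems E"
  using block_mem[OF partP] by auto

lemma Pcl_eq_iff: "e \<in> Elems E \<Longrightarrow> h \<in> Elems E \<Longrightarrow> Pcl E h = Pcl E e \<longleftrightarrow> h \<in> Pcl E e"
  by (rule block_eq_iff[OF partP])

lemma fbc_conds:
  "\<forall>e\<in>Elems E. Lcl E e \<subseteq> Pcl E e \<and> finite (Pcl E e)"
  "\<forall>e1\<in>Elems E. \<forall>e2\<in>Elems E.
     Lcl E e1 = Lcl E e2 \<longrightarrow> Pcl E (Act E g e1) = Pcl E (Act E g e2)"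
  "\<forall>e1\<in>Elems E. \<forall>e2\<in>Elems E. Pcl E e1 = Pcl E e2 \<longleftrightarrow>
     Pcl E (gpow G g E (Deg E e1) e1) = Pcl E (gpow G g E (Deg E e2) e2)"
  using is_fbc unfolding fbc_def by - (elim conjE, assumption)+

lemma Lcl_subset: "e \<in> Elems E \<Longrightarrow> Lcl E e \<subseteq> Pcl E e"
  using fbc_conds(1) by blast

lemma Lcl_imp_Pcl:
  assumes "e \<in> Elems E" "h \<in> Elems E" "Lcl E e = Lcl E h"
  shows "Pcl E e = Pcl E h"
proof -
  have "e \<in> Pcl E h"
    using block_mem(2)[OF partL assms(1)] Lcl_subset[OF assms(2)] assms(3) by auto
  then show ?thesis by (simp add: Pcl_eq_iff assms)
qed

lemma Lcl_Act:
  assumes "e \<in> Elems E" "h \<in> Elems E" "Lcl E e = Lcl E h"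
  shows "Pcl E (Act E g e) = Pcl E (Act E g h)"
  using fbc_conds(2) assms by blast

lemma Pcl_gpow:
  assumes "e \<in> Elems E" "h \<in> Elems E" "Pcl E e = Pcl E h"
  shows "Pcl E (gpow G g E (Deg E e) e) = Pcl E (gpow G g E (Deg E h) h)"
  using fbc_conds(3) assms by blast

lemma terminal_gwalk [simp]: "e \<in> Elems E \<Longrightarrow> terminal (gwalk G g E n e) = gpow G g E n e"
  by (cases n) auto

lemma is_walk_gwalk [simp]: "e \<in> Elems E \<Longrightarrow> is_walk G g E (gwalk G g E n e)"
  by (induction n) (auto simp: gpow_Suc simp del: nat_pow_Suc)

lemma is_step_Elems: "is_step G g E e' \<delta> e \<Longrightarrow> \<delta> \<noteq> Tau \<Longrightarrow> e \<in> Elems E \<Longrightarrow> e' \<in> Elems E"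
  by (cases \<delta>) auto

lemma is_step_flip: "is_step G g E e' \<delta> e \<Longrightarrow> e \<in> Elems E \<Longrightarrow> is_step G g E e (flip \<delta>) e'"
  by (cases \<delta>) auto

text \<open>Only (h3) and (h4) need the axioms: the final \<open>Tau\<close> step exists by
  \<open>Pcl_gpow\<close> for (h3) and by \<open>Lcl_Act\<close> for (h4), and the initial
  \<open>Tau\<close> step of (h4) exists because L-classes lie inside P-classes.\<close>

lemma homotopic_imp_walk:
  assumes "homotopic G g E v w"
  shows "is_walk G g E v \<and> is_walk G g E w \<and> source v = source w \<and> terminal v = terminal w"
  using assms
proof induction
  case (h3 e h)
  then show ?case using Pcl_gpow[OF h3] by auto
next
  case (h4 e h)
  then show ?case using Lcl_Act[OF h4] Lcl_imp_Pcl[OF h4] by auto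
qed auto

lemma homotopic_ends:
  assumes "homotopic G g E v w"
  shows "source v = source w" "terminal v = terminal w"
  using homotopic_imp_walk[OF assms] by auto

lemma homotopic_comp:
  assumes u: "homotopic G g E u u'" and v: "homotopic G g E v v'" and "source u = terminal v"
  shows "homotopic G g E (wcomp u v) (wcomp u' v')"
  using homotopic_imp_walk[OF u] homotopic_imp_walk[OF v] assms
  by (metis homotopic.h5_left homotopic.h5_right homotopic.trans)

lemma is_walk_winv [simp]: "is_walk G g E w \<Longrightarrow> is_walk G g E (winv w)"
  by (induction w) (auto simp: is_step_flip walk_Elems)

lemma edge_flip:
  assumes "e \<in> Elems E" "e' \<in> Elems E" "is_step G g E e' \<delta> e"
  shows "homotopic G g E (wcomp (edge e (flip \<delta>) e') (edge e' \<delta> e)) (Triv e)"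
proof (cases \<delta>)
  case Gen
  then show ?thesis using homotopic.h1_inv_gen[OF assms(1)] assms by auto
next
  case GenInv
  then show ?thesis using homotopic.h1_gen_inv[OF assms(1)] assms by auto
next
  case Tau
  then show ?thesis
    using homotopic.h2[of e E e' e G g] homotopic.h1_tau[OF assms(1)] assms
    by (auto intro: homotopic.trans)
qed

lemma winv_left:
  "is_walk G g E w \<Longrightarrow> homotopic G g E (wcomp (winv w) w) (Triv (source w))"
proof (induction w)
  case (Triv x)
  then show ?case by (auto intro: homotopic.refl)
next
  case (Step e \<delta> w)
  let ?t = "terminal w"
  have w: "is_walk G g E w" "?t \<in> Elems E" "e \<in> Elems E" "is_step G g E e \<delta> ?t"
    using Step.prems walk_Elems by auto
  have "homotopic G g E (wcomp (wcomp (edge ?t (flip \<delta>) e) (edge e \<delta> ?t)) w) (wcomp (Triv ?t) w)"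
    using homotopic.h5_right[OF edge_flip[OF w(2,3,4)] w(1)] by simp
  then have "homotopic G g E
      (wcomp (winv w) (wcomp (wcomp (edge ?t (flip \<delta>) e) (edge e \<delta> ?t)) w)) (wcomp (winv w) w)"
    using homotopic.h5_left[of G g E _ w "winv w"] w by simp
  then show ?case using Step.IH[OF w(1)] by (auto intro: homotopic.trans)
qed

lemma winv_right:
  "is_walk G g E w \<Longrightarrow> homotopic G g E (wcomp w (winv w)) (Triv (terminal w))"
proof (induction w)
  case (Triv x)
  then show ?case by (auto intro: homotopic.refl)
next
  case (Step e \<delta> w)
  let ?t = "terminal w"
  have w: "is_walk G g E w" "?t \<in> Elems E" "e \<in> Elems E" "is_step G g E e \<delta> ?t"
    using Step.prems walk_Elems by auto
  let ?b = "edge ?t (flip \<delta>) e" and ?a = "edge e \<delta> ?t"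
  have b: "is_walk G g E ?b" using w is_step_flip by auto
  have a: "is_walk G g E ?a" using w by auto
  have ff: "flip (flip \<delta>) = \<delta>" by (cases \<delta>) auto
  have "homotopic G g E (wcomp (wcomp w (winv w)) ?b) (wcomp (Triv ?t) ?b)"
    by (rule homotopic.h5_right[OF Step.IH[OF w(1)] b]) simp
  then have "homotopic G g E (wcomp ?a (wcomp (wcomp w (winv w)) ?b)) (wcomp ?a ?b)"
    using homotopic.h5_left[of G g E _ _ ?a] a by simp
  moreover have "homotopic G g E (wcomp ?a ?b) (Triv e)"
    using edge_flip[of e ?t "flip \<delta>"] w is_step_flip[OF w(4,2)] by (simp add: ff)
  ultimately show ?case by (auto intro: homotopic.trans)
qed

text \<open>The cutting device of the whole proof: with \<open>q\<close> starting in
  \<open>A\<close>, a walk is split at an interior point into two pieces that pass through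
  \<open>A\<close>.\<close>

lemma homotopic_insert:
  assumes "is_walk G g E u" "is_walk G g E v" "is_walk G g E q"
    and "source u = terminal q" "terminal v = terminal q"
  shows "homotopic G g E (wcomp u v) (wcomp (wcomp u q) (wcomp (winv q) v))"
proof -
  have "homotopic G g E (wcomp (wcomp q (winv q)) v) (wcomp (Triv (terminal q)) v)"
    by (rule homotopic.h5_right[OF winv_right]) (use assms in auto)
  then have "homotopic G g E (wcomp u (wcomp (wcomp q (winv q)) v)) (wcomp u v)"
    using homotopic.h5_left[of G g E _ _ u] assms by simp
  then show ?thesis by (auto intro: homotopic.sym)
qed


section \<open>The fundamental groupoid\<close>

abbreviation "hc \<equiv> hclass G g E"

text \<open>One side suffices: \<open>refl\<close> is restricted to walks, but if \<open>u\<close>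
  is a walk then it lies in its own class, hence in that of \<open>v\<close>.\<close>

lemma hclass_eq_iff: "is_walk G g E u \<Longrightarrow> hc u = hc v \<longleftrightarrow> homotopic G g E u v"
  unfolding hclass_def by (blast intro: homotopic.refl homotopic.sym homotopic.trans)

lemma hclass_self: "is_walk G g E w \<Longrightarrow> w \<in> hc w"
  unfolding hclass_def by (simp add: homotopic.refl)

lemma hclass_ends:
  assumes "is_walk G g E w"
  shows "the_elem (source ` hc w) = source w" "the_elem (terminal ` hc w) = terminal w"
proof -
  have "hc w \<noteq> {}" using hclass_self[OF assms] by blast
  moreover have "source v = source w" "terminal v = terminal w" if "v \<in> hc w" for v
    using that homotopic_ends[of w v] by (simp_all add: hclass_def)
  ultimately show "the_elem (source ` hc w) = source w" "the_elem (terminal ` hc w) = terminal w"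
    by (simp_all add: the_elem_image_unique)
qed

lemma hclass_wcomp:
  assumes "is_walk G g E u" "is_walk G g E v" "source u = terminal v"
  shows "(\<Union>u'\<in>hc u. \<Union>v'\<in>hc v. hc (wcomp u' v')) = hc (wcomp u v)"
proof -
  have eq: "hc (wcomp u' v') = hc (wcomp u v)" if "u' \<in> hc u" "v' \<in> hc v" for u' v'
  proof -
    have "homotopic G g E (wcomp u v) (wcomp u' v')"
      using that assms(3) homotopic_comp[of u u' v v'] by (simp add: hclass_def)
    then show ?thesis using assms hclass_eq_iff[of "wcomp u v" "wcomp u' v'"] by simp
  qed
  have "(\<Union>u'\<in>hc u. \<Union>v'\<in>hc v. hc (wcomp u' v')) = (\<Union>u'\<in>hc u. \<Union>v'\<in>hc v. hc (wcomp u v))"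
    by (intro SUP_cong eq) auto
  also have "\<dots> = hc (wcomp u v)"
    using hclass_self[OF assms(1)] hclass_self[OF assms(2)] by auto
  finally show ?thesis .
qed

abbreviation "FG A \<equiv> fundamental_groupoid G g E A"

lemma FG_simps [simp]:
  "Obj (FG A) = A"
  "Ident (FG A) x = hc (Triv x)"
  "is_walk G g E w \<Longrightarrow> Dom (FG A) (hc w) = source w"
  "is_walk G g E w \<Longrightarrow> Cod (FG A) (hc w) = terminal w"
  "is_walk G g E u \<Longrightarrow> is_walk G g E v \<Longrightarrow> source u = terminal v
    \<Longrightarrow> Comp (FG A) (hc u) (hc v) = hc (wcomp u v)"
  using hclass_ends hclass_wcomp by (simp_all add: fundamental_groupoid_def)

lemma FG_Arr:
  "c \<in> Arr (FG A) \<longleftrightarrow> (\<exists>w. c = hc w \<and> is_walk G g E w \<and> source w \<in> A \<and> terminal w \<in> A)"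
  by (auto simp: fundamental_groupoid_def)

lemma FG_ArrI [intro]:
  "is_walk G g E w \<Longrightarrow> source w \<in> A \<Longrightarrow> terminal w \<in> A \<Longrightarrow> hc w \<in> Arr (FG A)"
  using FG_Arr by auto

lemma FG_ArrE [elim]:
  assumes "c \<in> Arr (FG A)"
  obtains w where "c = hc w" "is_walk G g E w" "source w \<in> A" "terminal w \<in> A"
  using assms FG_Arr by auto

lemma groupoid_FG:
  assumes "A \<subseteq> Elems E"
  shows "groupoid (FG A)"
  unfolding groupoid_def
proof (intro conjI ballI impI)
  fix x assume "x \<in> Obj (FG A)"
  then have x: "is_walk G g E (Triv x)" "x \<in> A" using assms by auto
  then show "Ident (FG A) x \<in> Arr (FG A)" "Dom (FG A) (Ident (FG A) x) = x"
    "Cod (FG A) (Ident (FG A) x) = x"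
    using FG_ArrI[OF x(1)] FG_simps(3,4)[OF x(1)] by simp_all
next
  fix a assume "a \<in> Arr (FG A)"
  then obtain u where u: "a = hc u" "is_walk G g E u" "source u \<in> A" "terminal u \<in> A" by blast
  have ends: "is_walk G g E (Triv (source u))" "is_walk G g E (Triv (terminal u))"
    using walk_Elems[OF u(2)] by simp_all
  show "Dom (FG A) a \<in> Obj (FG A)" "Cod (FG A) a \<in> Obj (FG A)"
    using u by simp_all
  show "Comp (FG A) a (Ident (FG A) (Dom (FG A) a)) = a"
    "Comp (FG A) (Ident (FG A) (Cod (FG A) a)) a = a"
    using u ends FG_simps(5)[OF u(2) ends(1)] FG_simps(5)[OF ends(2) u(2)] by simp_all
  show "\<exists>b\<in>Arr (FG A). Dom (FG A) b = Cod (FG A) a \<and> Cod (FG A) b = Dom (FG A) a \<and>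
    Comp (FG A) b a = Ident (FG A) (Dom (FG A) a) \<and> Comp (FG A) a b = Ident (FG A) (Cod (FG A) a)"
  proof (rule bexI[of _ "hc (winv u)"])
    have "hc (wcomp (winv u) u) = hc (Triv (source u))"
      "hc (wcomp u (winv u)) = hc (Triv (terminal u))"
      using winv_left[OF u(2)] winv_right[OF u(2)] u(2) by (simp_all add: hclass_eq_iff)
    then show "Dom (FG A) (hc (winv u)) = Cod (FG A) a \<and> Cod (FG A) (hc (winv u)) = Dom (FG A) a \<and>
      Comp (FG A) (hc (winv u)) a = Ident (FG A) (Dom (FG A) a) \<and>
      Comp (FG A) a (hc (winv u)) = Ident (FG A) (Cod (FG A) a)"
      using u by simp
    show "hc (winv u) \<in> Arr (FG A)" using u by (intro FG_ArrI) simp_all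
  qed
  fix b assume "b \<in> Arr (FG A)"
  then obtain v where v: "b = hc v" "is_walk G g E v" "source v \<in> A" "terminal v \<in> A" by blast
  {
    assume "Dom (FG A) a = Cod (FG A) b"
    then have uv: "source u = terminal v" using u v by simp
    then show "Comp (FG A) a b \<in> Arr (FG A)" "Dom (FG A) (Comp (FG A) a b) = Dom (FG A) b"
      "Cod (FG A) (Comp (FG A) a b) = Cod (FG A) a"
      using u v FG_ArrI[of "wcomp u v" A] by simp_all
    fix c assume "c \<in> Arr (FG A)" "Dom (FG A) b = Cod (FG A) c"
    then obtain w where w: "c = hc w" "is_walk G g E w" "source v = terminal w"
      using v by auto
    then show "Comp (FG A) (Comp (FG A) a b) c = Comp (FG A) a (Comp (FG A) b c)"
      using u v uv by simp
  }
qed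

end


section \<open>Sub-configurations\<close>

text \<open>Serves two kinds of inclusion: of a member into \<open>E\<close>, and of one member into
  another.\<close>

locale sub_frac_brauer = frac_brauer G g E for G :: "'g monoid" and g :: 'g
    and E :: "('g, 'e) fbc_data" +
  fixes K :: "('g, 'e) fbc_data"
  assumes sub: "sub_fbc G g K E"
begin

sublocale K: frac_brauer G g K
  using sub group_G g_carrier by (intro frac_brauer.intro) (simp_all only: sub_fbc_def)

lemma sub_Elems [simp]: "e \<in> Elems K \<Longrightarrow> e \<in> Elems E"
  using sub unfolding sub_fbc_def by blast

lemma sub_Act: "x \<in> carrier G \<Longrightarrow> e \<in> Elems K \<Longrightarrow> Act K x e = Act E x e"
  using sub unfolding sub_fbc_def fbc_morphism_def by blast

lemma sub_Deg: "e \<in> Elems K \<Longrightarrow> Deg K e = Deg E e"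
  using sub unfolding sub_fbc_def fbc_morphism_def by simp

lemma sub_Pcl: "e \<in> Elems K \<Longrightarrow> Pcl K e \<subseteq> Pcl E e"
  and sub_Lcl: "e \<in> Elems K \<Longrightarrow> Lcl K e \<subseteq> Lcl E e"
  using sub unfolding sub_fbc_def fbc_morphism_def by (simp_all only: image_ident)

lemma sub_Pcl_eq:
  assumes "e \<in> Elems K" "h \<in> Elems K" "Pcl K e = Pcl K h"
  shows "Pcl E e = Pcl E h"
  using assms sub_Pcl[OF assms(2)] K.Pcl_Elems(1)[OF assms(1)]
  by (subst Pcl_eq_iff) auto

lemma sub_Lcl_eq:
  assumes "e \<in> Elems K" "h \<in> Elems K" "Lcl K e = Lcl K h"
  shows "Lcl E e = Lcl E h"
  using assms sub_Lcl[OF assms(2)] block_mem(2)[OF K.partL assms(1)]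
  by (subst block_eq_iff[OF partL]) auto

lemma sub_is_step:
  assumes "is_step G g K e' \<delta> e" "e \<in> Elems K" "e' \<in> Elems K"
  shows "is_step G g E e' \<delta> e"
  using assms sub_Pcl_eq[OF assms(3,2)] by (cases \<delta>) (simp_all add: sub_Act)

lemma sub_is_walk: "is_walk G g K w \<Longrightarrow> is_walk G g E w"
  by (induction w) (auto intro!: sub_is_step simp: walk_Elems)

lemma sub_gwalk: "e \<in> Elems K \<Longrightarrow> gwalk G g K n e = gwalk G g E n e"
  by (induction n) (simp_all only: gwalk.simps sub_Act g_facts)

text \<open>Action and degree agree on \<open>K\<close>, so the g-power walks in (h3) are literally
  the same walks, and equality of classes passes from \<open>K\<close> to \<open>E\<close>; every
  generating relation of \<open>K\<close> is therefore one of \<open>E\<close>.\<close>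

lemma sub_homotopic:
  assumes "homotopic G g K u v"
  shows "homotopic G g E u v"
  using assms
proof induction
  case (refl w)
  then show ?case by (intro homotopic.refl sub_is_walk)
next
  case (sym v w)
  then show ?case by (blast intro: homotopic.sym)
next
  case (trans u v w)
  then show ?case by (blast intro: homotopic.trans)
next
  case (h1_inv_gen e)
  then show ?case using homotopic.h1_inv_gen[of e E G g] by (simp add: sub_Act)
next
  case (h1_gen_inv e)
  then show ?case using homotopic.h1_gen_inv[of e E G g] by (simp add: sub_Act)
next
  case (h1_tau e)
  then show ?case by (simp add: homotopic.h1_tau)
next
  case (h2 e0 e1 e2)
  then show ?case using homotopic.h2[of e0 E e1 e2 G g] sub_Pcl_eq[OF h2(2,1,4)] sub_Pcl_eq[OF h2(3,2,5)] by simp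
next
  case (h3 e h)
  then show ?case
    using homotopic.h3[of e E h G g] sub_Pcl_eq[OF h3]
    by (simp add: sub_Act sub_Deg sub_gwalk del: wcomp.simps)
next
  case (h4 e h)
  then show ?case
    using homotopic.h4[of e E h G g] sub_Lcl_eq[OF h4] by (simp add: sub_Act)
next
  case (h5_left v w u)
  then show ?case by (intro homotopic.h5_left sub_is_walk)
next
  case (h5_right v w u)
  then show ?case by (intro homotopic.h5_right sub_is_walk)
qed

lemma induced_hclass:
  assumes "is_walk G g K w"
  shows "snd (induced_functor G g E (\<lambda>e. e)) (hclass G g K w) = hc w"
proof -
  have "hc w' = hc w" if "w' \<in> hclass G g K w" for w'
    using that sub_homotopic assms sub_is_walk hclass_eq_iff[of w w'] by (simp add: hclass_def)
  then have "(\<Union>w'\<in>hclass G g K w. hc w') = (\<Union>w'\<in>hclass G g K w. hc w)"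
    by (intro SUP_cong) auto
  also have "\<dots> = hc w" using K.hclass_self[OF assms] by auto
  finally show ?thesis by (simp add: induced_functor_def walk.map_ident)
qed

lemma induced_functor_sub:
  assumes "A \<subseteq> Elems K"
  shows "is_functor (K.FG A) (FG A) (induced_functor G g E (\<lambda>e. e))"
  unfolding is_functor_def
proof (intro conjI ballI impI)
  let ?J = "induced_functor G g E (\<lambda>e. e)"
  have ob: "fst ?J x = x" for x :: 'e by (simp add: induced_functor_def)
  show "fst ?J x \<in> Obj (FG A)" if "x \<in> Obj (K.FG A)" for x using that by (simp add: ob)
  show "snd ?J (Ident (K.FG A) x) = Ident (FG A) (fst ?J x)" if "x \<in> Obj (K.FG A)" for x
    using that assms induced_hclass[of "Triv x"] by (auto simp: ob)
  fix a assume "a \<in> Arr (K.FG A)"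
  then obtain u where u: "a = hclass G g K u" "is_walk G g K u" "source u \<in> A" "terminal u \<in> A"
    by blast
  note u' = sub_is_walk[OF u(2)]
  show "snd ?J a \<in> Arr (FG A)" "Dom (FG A) (snd ?J a) = fst ?J (Dom (K.FG A) a)"
    "Cod (FG A) (snd ?J a) = fst ?J (Cod (K.FG A) a)"
    using u u' FG_ArrI by (simp_all add: ob induced_hclass)
  fix b assume "b \<in> Arr (K.FG A)" "Dom (K.FG A) a = Cod (K.FG A) b"
  then obtain v where v: "b = hclass G g K v" "is_walk G g K v" "source u = terminal v"
    using u by auto
  then show "snd ?J (Comp (K.FG A) a b) = Comp (FG A) (snd ?J a) (snd ?J b)"
    using u u' sub_is_walk[OF v(2)] by (simp add: induced_hclass)
qed

end


section \<open>Arrows of a groupoid\<close>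

locale gpd_arrows =
  fixes H :: "('p, 'n) gpd"
  assumes gpd: "groupoid H"
begin

text \<open>\<open>Comp\<close> is total but obeys the groupoid laws only on composable pairs;
  membership in \<open>hom\<close> acts as the typing judgement under which the laws may be
  used.\<close>

definition hom :: "'p \<Rightarrow> 'p \<Rightarrow> 'n set" where
  "hom x y = {a \<in> Arr H. Dom H a = x \<and> Cod H a = y}"

definition ginv :: "'n \<Rightarrow> 'n" where
  "ginv a = (SOME b. b \<in> hom (Cod H a) (Dom H a) \<and>
     Comp H b a = Ident H (Dom H a) \<and> Comp H a b = Ident H (Cod H a))"

abbreviation gcomp :: "'n \<Rightarrow> 'n \<Rightarrow> 'n" (infixr "\<bullet>" 70) where
  "a \<bullet> b \<equiv> Comp H a b"

lemma hom_Obj: "a \<in> hom x y \<Longrightarrow> x \<in> Obj H \<and> y \<in> Obj H"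
  using gpd unfolding groupoid_def hom_def by blast

lemma ident_hom [intro]: "x \<in> Obj H \<Longrightarrow> Ident H x \<in> hom x x"
  using gpd unfolding groupoid_def hom_def by blast

lemma comp_hom [intro]:
  assumes "a \<in> hom y z" "b \<in> hom x y"
  shows "a \<bullet> b \<in> hom x z"
proof -
  have "\<forall>a\<in>Arr H. \<forall>b\<in>Arr H. Dom H a = Cod H b \<longrightarrow>
        Comp H a b \<in> Arr H \<and> Dom H (Comp H a b) = Dom H b \<and> Cod H (Comp H a b) = Cod H a"
    using gpd unfolding groupoid_def by (elim conjE) assumption
  then show ?thesis using assms unfolding hom_def by simp
qed

lemma comp_assoc:
  assumes "a \<in> hom y z" "b \<in> hom x y" "c \<in> hom w x"
  shows "(a \<bullet> b) \<bullet> c = a \<bullet> (b \<bullet> c)"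
proof -
  have "\<forall>a\<in>Arr H. \<forall>b\<in>Arr H. \<forall>c\<in>Arr H. Dom H a = Cod H b \<longrightarrow> Dom H b = Cod H c \<longrightarrow>
        Comp H (Comp H a b) c = Comp H a (Comp H b c)"
    using gpd unfolding groupoid_def by (elim conjE) assumption
  then show ?thesis using assms unfolding hom_def by simp
qed

lemma ident_right: "a \<in> hom x y \<Longrightarrow> a \<bullet> Ident H x = a"
  and ident_left: "a \<in> hom x y \<Longrightarrow> Ident H y \<bullet> a = a"
  using gpd unfolding groupoid_def hom_def by blast+

lemma ginv_props:
  assumes "a \<in> hom x y"
  shows "ginv a \<in> hom y x" "ginv a \<bullet> a = Ident H x" "a \<bullet> ginv a = Ident H y"
proof -
  have "\<forall>a\<in>Arr H. \<exists>b\<in>Arr H. Dom H b = Cod H a \<and> Cod H b = Dom H a \<and>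
        Comp H b a = Ident H (Dom H a) \<and> Comp H a b = Ident H (Cod H a)"
    using gpd unfolding groupoid_def by (elim conjE) assumption
  then have "\<exists>b. b \<in> hom (Cod H a) (Dom H a) \<and>
     Comp H b a = Ident H (Dom H a) \<and> Comp H a b = Ident H (Cod H a)"
    using assms unfolding hom_def by blast
  from someI_ex[OF this, folded ginv_def]
  show "ginv a \<in> hom y x" "ginv a \<bullet> a = Ident H x" "a \<bullet> ginv a = Ident H y"
    using assms unfolding hom_def by auto
qed

lemma comp_ginv_cancel:
  assumes "a \<in> hom x y" "b \<in> hom x z"
  shows "(b \<bullet> ginv a) \<bullet> a = b"
  using assms ginv_props[OF assms(1)] comp_assoc[OF assms(2) ginv_props(1)[OF assms(1)] assms(1)]
    ident_right by simp

lemma cancel_right: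
  assumes "a \<in> hom y z" "b \<in> hom y z" "c \<in> hom x y" "a \<bullet> c = b \<bullet> c"
  shows "a = b"
  using assms comp_assoc[OF assms(1,3) ginv_props(1)[OF assms(3)]]
    comp_assoc[OF assms(2,3) ginv_props(1)[OF assms(3)]] ginv_props(3)[OF assms(3)] ident_right
  by metis

end


section \<open>Extending local functors beyond the base points\<close>

text \<open>Here \<open>f\<close> takes walks, so that compatibility of the functors becomes
  equality on walks shared by two members (\<open>f_common\<close>). Closure under intersections
  enters through \<open>common\<close>: a point lying in finitely many members is reached from
  \<open>A\<close> by one walk lying in all of them.\<close>

locale local_functors = gpd_arrows H for H :: "('p, 'n) gpd" +
  fixes G :: "'g monoid" and g :: 'g
    and I :: "'i set" and F :: "'i \<Rightarrow> ('g, 'e) fbc_data" and A :: "'e set"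
    and ob :: "'e \<Rightarrow> 'p" and f :: "'i \<Rightarrow> 'e walk \<Rightarrow> 'n"
  assumes frac: "\<alpha> \<in> I \<Longrightarrow> frac_brauer G g (F \<alpha>)"
    and common: "\<lbrakk> finite J; J \<noteq> {}; J \<subseteq> I; \<And>\<alpha>. \<alpha> \<in> J \<Longrightarrow> x \<in> Elems (F \<alpha>) \<rbrakk> \<Longrightarrow>
      \<exists>r. (\<forall>\<alpha>\<in>J. is_walk G g (F \<alpha>) r) \<and> source r \<in> A \<and> terminal r = x"
    and f_hom: "\<lbrakk> \<alpha> \<in> I; is_walk G g (F \<alpha>) w; source w \<in> A; terminal w \<in> A \<rbrakk> \<Longrightarrow>
      f \<alpha> w \<in> hom (ob (source w)) (ob (terminal w))"
    and f_triv: "\<lbrakk> \<alpha> \<in> I; a \<in> A \<rbrakk> \<Longrightarrow> f \<alpha> (Triv a) = Ident H (ob a)"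
    and f_comp: "\<lbrakk> \<alpha> \<in> I; is_walk G g (F \<alpha>) u; is_walk G g (F \<alpha>) v; source u = terminal v;
      source v \<in> A; terminal v \<in> A; terminal u \<in> A \<rbrakk> \<Longrightarrow> f \<alpha> (wcomp u v) = f \<alpha> u \<bullet> f \<alpha> v"
    and f_homotopic: "\<lbrakk> \<alpha> \<in> I; homotopic G g (F \<alpha>) u v; source u \<in> A; terminal u \<in> A \<rbrakk> \<Longrightarrow>
      f \<alpha> u = f \<alpha> v"
    and f_common: "\<lbrakk> \<alpha> \<in> I; \<beta> \<in> I; is_walk G g (F \<alpha>) w; is_walk G g (F \<beta>) w;
      source w \<in> A; terminal w \<in> A \<rbrakk> \<Longrightarrow> f \<alpha> w = f \<beta> w"
begin

abbreviation wk :: "'i \<Rightarrow> 'e walk \<Rightarrow> bool" where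
  "wk \<alpha> w \<equiv> is_walk G g (F \<alpha>) w"

abbreviation anch :: "'i \<Rightarrow> 'e walk \<Rightarrow> bool" where
  "anch \<alpha> w \<equiv> is_walk G g (F \<alpha>) w \<and> source w \<in> A"

lemmas wk_Elems = walk_Elems[of G g "F \<alpha>" for \<alpha>]

lemma wk_winv [simp]: "\<alpha> \<in> I \<Longrightarrow> wk \<alpha> w \<Longrightarrow> wk \<alpha> (winv w)"
  using frac_brauer.is_walk_winv[OF frac] .

lemma common2:
  assumes "\<alpha> \<in> I" "\<beta> \<in> I" "x \<in> Elems (F \<alpha>)" "x \<in> Elems (F \<beta>)"
  obtains r where "anch \<alpha> r" "anch \<beta> r" "terminal r = x"
  using common[of "{\<alpha>, \<beta>}" x] assms by auto

lemma common3:
  assumes "\<alpha> \<in> I" "\<beta> \<in> I" "\<gamma> \<in> I" "x \<in> Elems (F \<alpha>)" "x \<in> Elems (F \<beta>)" "x \<in> Elems (F \<gamma>)"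
  obtains r where "anch \<alpha> r" "anch \<beta> r" "anch \<gamma> r" "terminal r = x"
  using common[of "{\<alpha>, \<beta>, \<gamma>}" x] assms by auto

section \<open>Chosen walks from the base points\<close>

definition home :: "'e \<Rightarrow> 'i" where
  "home x = (SOME \<alpha>. \<alpha> \<in> I \<and> x \<in> Elems (F \<alpha>))"

text \<open>The trivial walk is prescribed at points of \<open>A\<close> so that the extension
  restricts to the given data there, see \<open>Ob_A\<close> and \<open>V_A\<close>.\<close>

definition base :: "'e \<Rightarrow> 'e walk" where
  "base x = (if x \<in> A then Triv x
     else SOME r. is_walk G g (F (home x)) r \<and> source r \<in> A \<and> terminal r = x)"

definition link :: "'i \<Rightarrow> 'e \<Rightarrow> 'e walk" where
  "link \<alpha> x = (SOME r. anch \<alpha> r \<and> is_walk G g (F (home x)) r \<and> terminal r = x)"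

text \<open>An extension is determined only up to isomorphism at points outside \<open>A\<close>;
  this choice makes \<open>base x\<close> play the role of an identity.\<close>

definition Ob :: "'e \<Rightarrow> 'p" where
  "Ob x = ob (source (base x))"

lemma home:
  assumes "\<alpha> \<in> I" "x \<in> Elems (F \<alpha>)"
  shows "home x \<in> I" "x \<in> Elems (F (home x))"
  using someI_ex[of "\<lambda>\<alpha>. \<alpha> \<in> I \<and> x \<in> Elems (F \<alpha>)"] assms unfolding home_def by blast+

lemma base:
  assumes "\<alpha> \<in> I" "x \<in> Elems (F \<alpha>)"
  shows "wk (home x) (base x)" "source (base x) \<in> A" "terminal (base x) = x"
proof -
  note h = home[OF assms]
  have "\<exists>r. wk (home x) r \<and> source r \<in> A \<and> terminal r = x"
    using common2[OF h(1) h(1) h(2) h(2)] by blast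
  from someI_ex[OF this]
  have "wk (home x) (base x) \<and> source (base x) \<in> A \<and> terminal (base x) = x"
    using h(2) unfolding base_def by simp
  then show "wk (home x) (base x)" "source (base x) \<in> A" "terminal (base x) = x" by auto
qed

lemma link:
  assumes "\<alpha> \<in> I" "x \<in> Elems (F \<alpha>)"
  shows "wk \<alpha> (link \<alpha> x)" "wk (home x) (link \<alpha> x)" "source (link \<alpha> x) \<in> A" "terminal (link \<alpha> x) = x"
proof -
  note h = home[OF assms]
  have "\<exists>r. anch \<alpha> r \<and> wk (home x) r \<and> terminal r = x"
    using common2[OF assms(1) h(1) assms(2) h(2)] by blast
  from someI_ex[OF this, folded link_def]
  show "wk \<alpha> (link \<alpha> x)" "wk (home x) (link \<alpha> x)" "source (link \<alpha> x) \<in> A" "terminal (link \<alpha> x) = x"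
    by auto
qed

lemma base_A: "a \<in> A \<Longrightarrow> base a = Triv a"
  by (simp add: base_def)

lemma Ob_A: "a \<in> A \<Longrightarrow> Ob a = ob a"
  by (simp add: Ob_def base_A)

text \<open>
  The arrow that a walk \<open>q\<close> of \<open>F \<alpha>\<close> from \<open>A\<close> to \<open>x\<close>, followed by the inverse of \<open>base x\<close>,
  should have. As \<open>base x\<close> need not lie in \<open>F \<alpha>\<close>, the detour through \<open>r\<close>, which lies in
  both \<open>F \<alpha>\<close> and \<open>F (home x)\<close>, is needed to evaluate it.
\<close>

definition via :: "'i \<Rightarrow> 'e walk \<Rightarrow> 'e walk \<Rightarrow> 'n" where
  "via \<alpha> r q = f (home (terminal q)) (wcomp (winv (base (terminal q))) r) \<bullet> f \<alpha> (wcomp (winv r) q)"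

definition theta :: "'i \<Rightarrow> 'e walk \<Rightarrow> 'n" where
  "theta \<alpha> q = via \<alpha> (link \<alpha> (terminal q)) q"

lemma via_hom1:
  assumes "\<alpha> \<in> I" "anch \<alpha> q" "anch \<alpha> r" "wk (home (terminal q)) r" "terminal r = terminal q"
  shows "f (home (terminal q)) (wcomp (winv (base (terminal q))) r) \<in> hom (ob (source r)) (Ob (terminal q))"
proof -
  let ?x = "terminal q" and ?\<sigma> = "home (terminal q)"
  have x: "?x \<in> Elems (F \<alpha>)" using assms wk_Elems by blast
  note b = base[OF assms(1) x] and h = home[OF assms(1) x]
  show ?thesis
    using f_hom[OF h(1), of "wcomp (winv (base ?x)) r"] assms b h by (simp add: Ob_def)
qed

lemma via_hom2:
  assumes "\<alpha> \<in> I" "anch \<alpha> q" "anch \<alpha> r" "terminal r = terminal q"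
  shows "f \<alpha> (wcomp (winv r) q) \<in> hom (ob (source q)) (ob (source r))"
  using f_hom[of \<alpha> "wcomp (winv r) q"] assms by simp

text \<open>The walk \<open>wcomp (winv r) s\<close> runs from \<open>A\<close> to \<open>A\<close>
  and lies in both \<open>F \<alpha>\<close> and the home of the endpoint. By
  \<open>f_common\<close> its value can be moved from the left factor to the right one.\<close>

lemma via_indep:
  assumes "\<alpha> \<in> I" "anch \<alpha> q"
    and r: "anch \<alpha> r" "wk (home (terminal q)) r" "terminal r = terminal q"
    and s: "anch \<alpha> s" "wk (home (terminal q)) s" "terminal s = terminal q"
  shows "via \<alpha> s q = via \<alpha> r q"
proof -
  let ?x = "terminal q" and ?\<sigma> = "home (terminal q)"
  have x: "?x \<in> Elems (F \<alpha>)" using assms wk_Elems by blast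
  note b = base[OF assms(1) x] and h = home[OF assms(1) x]
  have "f ?\<sigma> (wcomp (winv (base ?x)) s)
      = f ?\<sigma> (wcomp (wcomp (winv (base ?x)) r) (wcomp (winv r) s))"
    by (rule f_homotopic[OF h(1) frac_brauer.homotopic_insert[OF frac[OF h(1)]]])
      (use b h r s in simp_all)
  also have "\<dots> = f ?\<sigma> (wcomp (winv (base ?x)) r) \<bullet> f ?\<sigma> (wcomp (winv r) s)"
    using b h r s by (intro f_comp[OF h(1)]) simp_all
  also have "f ?\<sigma> (wcomp (winv r) s) = f \<alpha> (wcomp (winv r) s)"
    using b h r s assms(1) by (intro f_common) simp_all
  finally have 1: "f ?\<sigma> (wcomp (winv (base ?x)) s)
      = f ?\<sigma> (wcomp (winv (base ?x)) r) \<bullet> f \<alpha> (wcomp (winv r) s)" .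
  have "f \<alpha> (wcomp (winv r) q) = f \<alpha> (wcomp (wcomp (winv r) s) (wcomp (winv s) q))"
    by (rule f_homotopic[OF assms(1) frac_brauer.homotopic_insert[OF frac[OF assms(1)]]])
      (use r s assms(1,2) in simp_all)
  also have "\<dots> = f \<alpha> (wcomp (winv r) s) \<bullet> f \<alpha> (wcomp (winv s) q)"
    using assms by (intro f_comp[OF assms(1)]) simp_all
  finally have 2: "f \<alpha> (wcomp (winv r) q) = f \<alpha> (wcomp (winv r) s) \<bullet> f \<alpha> (wcomp (winv s) q)" .
  have m: "f \<alpha> (wcomp (winv r) s) \<in> hom (ob (source s)) (ob (source r))"
    using f_hom[of \<alpha> "wcomp (winv r) s"] assms by simp
  show ?thesis
    unfolding via_def 1 2
    by (rule comp_assoc[OF via_hom1[OF assms(1,2) r] m via_hom2[OF assms(1,2) s(1,3)]])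
qed

lemma theta_eq_via:
  assumes "\<alpha> \<in> I" "anch \<alpha> q" "anch \<alpha> r" "wk (home (terminal q)) r" "terminal r = terminal q"
  shows "theta \<alpha> q = via \<alpha> r q"
proof -
  have x: "terminal q \<in> Elems (F \<alpha>)" using assms wk_Elems by blast
  show ?thesis unfolding theta_def
    by (rule via_indep) (use link[OF assms(1) x] assms in simp_all)
qed

lemma theta_hom:
  assumes "\<alpha> \<in> I" "anch \<alpha> q"
  shows "theta \<alpha> q \<in> hom (ob (source q)) (Ob (terminal q))"
proof -
  have x: "terminal q \<in> Elems (F \<alpha>)" using assms wk_Elems by blast
  note l = link[OF assms(1) x]
  show ?thesis unfolding theta_def via_def
    by (rule comp_hom[OF via_hom1 via_hom2]) (use l assms in simp_all)
qed

lemma theta_comp: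
  assumes "\<alpha> \<in> I" "anch \<alpha> q" "anch \<alpha> u" "terminal u = source q"
  shows "theta \<alpha> (wcomp q u) = theta \<alpha> q \<bullet> f \<alpha> u"
proof -
  have x: "terminal q \<in> Elems (F \<alpha>)" using assms wk_Elems by blast
  let ?r = "link \<alpha> (terminal q)"
  note l = link[OF assms(1) x]
  have "f \<alpha> (wcomp (wcomp (winv ?r) q) u) = f \<alpha> (wcomp (winv ?r) q) \<bullet> f \<alpha> u"
    using assms l by (intro f_comp) simp_all
  moreover have "f \<alpha> u \<in> hom (ob (source u)) (ob (source q))"
    using f_hom[of \<alpha> u] assms by simp
  moreover have "f (home (terminal q)) (wcomp (winv (base (terminal q))) ?r) \<in> hom (ob (source ?r)) (Ob (terminal q))"
    using via_hom1[OF assms(1,2), of ?r] l by simp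
  moreover have "f \<alpha> (wcomp (winv ?r) q) \<in> hom (ob (source q)) (ob (source ?r))"
    using via_hom2[OF assms(1,2), of ?r] l by simp
  ultimately show ?thesis unfolding theta_def via_def
    using comp_assoc assms(4) by simp
qed

lemma theta_homotopic:
  assumes "\<alpha> \<in> I" "homotopic G g (F \<alpha>) q q'" "source q \<in> A"
  shows "theta \<alpha> q = theta \<alpha> q'"
proof -
  note E = frac_brauer.homotopic_imp_walk[OF frac[OF assms(1)] assms(2)]
  have x: "terminal q \<in> Elems (F \<alpha>)" using E wk_Elems by blast
  note l = link[OF assms(1) x]
  have "f \<alpha> (wcomp (winv (link \<alpha> (terminal q))) q) = f \<alpha> (wcomp (winv (link \<alpha> (terminal q))) q')"
    using assms l by (intro f_homotopic[OF assms(1)] homotopic.h5_left) simp_all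
  then show ?thesis unfolding theta_def via_def using E by simp
qed

text \<open>Three members meet here, \<alpha>, \<beta> and the home of the endpoint. A detour
  \<open>r\<close> in all three makes the left factors of both sides identical, and
  \<open>f_common\<close> compares the right factors.\<close>

lemma theta_common:
  assumes "\<alpha> \<in> I" "\<beta> \<in> I" "anch \<alpha> q" "anch \<beta> q"
  shows "theta \<alpha> q = theta \<beta> q"
proof -
  let ?x = "terminal q"
  have x: "?x \<in> Elems (F \<alpha>)" "?x \<in> Elems (F \<beta>)" using assms wk_Elems by blast+
  note h = home[OF assms(1) x(1)]
  obtain r where r: "anch \<alpha> r" "anch \<beta> r" "anch (home ?x) r" "terminal r = ?x"
    using common3[OF assms(1,2) h(1) x h(2)] .
  have "f \<alpha> (wcomp (winv r) q) = f \<beta> (wcomp (winv r) q)"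
    using assms r by (intro f_common) simp_all
  then have "via \<alpha> r q = via \<beta> r q" by (simp add: via_def)
  then show ?thesis
    using theta_eq_via[OF assms(1,3) r(1) _ r(4)] theta_eq_via[OF assms(2,4) r(2) _ r(4)] r(3) by simp
qed

lemma theta_A:
  assumes "\<alpha> \<in> I" "anch \<alpha> q" "terminal q \<in> A"
  shows "theta \<alpha> q = f \<alpha> q"
proof -
  let ?x = "terminal q"
  have x: "?x \<in> Elems (F \<alpha>)" using assms wk_Elems by blast
  note h = home[OF assms(1) x]
  \<comment> \<open>At a point of \<open>A\<close> the trivial walk is itself an admissible detour,
    and \<open>base\<close> is trivial too, so the left factor becomes an identity.\<close>
  have "theta \<alpha> q = via \<alpha> (Triv ?x) q"
    using assms x h by (intro theta_eq_via) simp_all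
  also have "\<dots> = Ident H (ob ?x) \<bullet> f \<alpha> q"
    using assms h by (simp add: via_def base_A f_triv)
  also have "\<dots> = f \<alpha> q" using ident_left[OF f_hom] assms by simp
  finally show ?thesis .
qed

section \<open>Values of arbitrary walks of one member\<close>

definition V :: "'i \<Rightarrow> 'e walk \<Rightarrow> 'n" where
  "V \<alpha> w = theta \<alpha> (wcomp w (link \<alpha> (source w))) \<bullet> ginv (theta \<alpha> (link \<alpha> (source w)))"

lemma V_hom:
  assumes "\<alpha> \<in> I" "wk \<alpha> w"
  shows "V \<alpha> w \<in> hom (Ob (source w)) (Ob (terminal w))"
proof -
  let ?q = "link \<alpha> (source w)"
  note l = link[OF assms(1) wk_Elems(1)[OF assms(2)]]
  have "theta \<alpha> ?q \<in> hom (ob (source ?q)) (Ob (source w))"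
    using theta_hom[OF assms(1), of ?q] l by simp
  moreover have "theta \<alpha> (wcomp w ?q) \<in> hom (ob (source ?q)) (Ob (terminal w))"
    using theta_hom[OF assms(1), of "wcomp w ?q"] l assms by simp
  ultimately show ?thesis unfolding V_def using ginv_props(1) comp_hom by blast
qed

text \<open>Frees \<open>V\<close> from the choice of \<open>link\<close> in its definition: two
  walks \<open>q\<close> and \<open>?r\<close> from \<open>A\<close> to the same point differ by a
  walk with both ends in \<open>A\<close>, on which \<open>theta\<close> is multiplicative. Thus
  \<open>V \<alpha> w\<close> is the only arrow with this property (\<open>V_unique\<close>), and
  its functoriality follows from that.\<close>

lemma theta_wcomp:
  assumes "\<alpha> \<in> I" "wk \<alpha> w" "anch \<alpha> q" "terminal q = source w"
  shows "theta \<alpha> (wcomp w q) = V \<alpha> w \<bullet> theta \<alpha> q"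
proof -
  interpret fb: frac_brauer G g "F \<alpha>" by (rule frac[OF assms(1)])
  let ?r = "link \<alpha> (source w)"
  note l = link[OF assms(1) wk_Elems(1)[OF assms(2)]]
  have th: "theta \<alpha> ?r \<in> hom (ob (source ?r)) (Ob (source w))"
    using theta_hom[OF assms(1), of ?r] l by simp
  have thw: "theta \<alpha> (wcomp w ?r) \<in> hom (ob (source ?r)) (Ob (terminal w))"
    using theta_hom[OF assms(1), of "wcomp w ?r"] l assms by simp
  \<comment> \<open>The difference between \<open>q\<close> and the chosen link; both its ends are
    in \<open>A\<close>, so \<open>f\<close> applies to it.\<close>
  let ?u = "wcomp (winv ?r) q"
  have u: "f \<alpha> ?u \<in> hom (ob (source q)) (ob (source ?r))"
    using f_hom[OF assms(1), of ?u] l assms by simp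
  have "theta \<alpha> (wcomp w q) = theta \<alpha> (wcomp (wcomp w ?r) ?u)"
    by (rule theta_homotopic[OF assms(1) fb.homotopic_insert]) (use l assms in simp_all)
  also have "\<dots> = theta \<alpha> (wcomp w ?r) \<bullet> f \<alpha> ?u"
    using l assms by (intro theta_comp) simp_all
  also have "theta \<alpha> (wcomp w ?r) = V \<alpha> w \<bullet> theta \<alpha> ?r"
    unfolding V_def using comp_ginv_cancel[OF th thw] by simp
  also have "(V \<alpha> w \<bullet> theta \<alpha> ?r) \<bullet> f \<alpha> ?u = V \<alpha> w \<bullet> (theta \<alpha> ?r \<bullet> f \<alpha> ?u)"
    by (rule comp_assoc[OF V_hom[OF assms(1,2)] th u])
  also have "theta \<alpha> ?r \<bullet> f \<alpha> ?u = theta \<alpha> (wcomp ?r ?u)"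
    using l assms by (intro theta_comp[symmetric]) simp_all
  also have "\<dots> = theta \<alpha> q"
    using fb.homotopic_insert[of "Triv (terminal q)" q ?r] l assms wk_Elems(2)[of \<alpha> q]
    by (intro theta_homotopic) (auto intro: homotopic.sym)
  finally show ?thesis .
qed

lemma V_unique:
  assumes "\<alpha> \<in> I" "wk \<alpha> w" "anch \<alpha> q" "terminal q = source w"
    and "m \<in> hom (Ob (source w)) (Ob (terminal w))" "theta \<alpha> (wcomp w q) = m \<bullet> theta \<alpha> q"
  shows "V \<alpha> w = m"
proof (rule cancel_right[OF V_hom[OF assms(1,2)] assms(5)])
  show "theta \<alpha> q \<in> hom (ob (source q)) (Ob (source w))"
    using theta_hom[OF assms(1,3)] assms(4) by simp
  show "V \<alpha> w \<bullet> theta \<alpha> q = m \<bullet> theta \<alpha> q"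
    using theta_wcomp[OF assms(1-4)] assms(6) by simp
qed

lemma Ob_Obj:
  assumes "\<alpha> \<in> I" "x \<in> Elems (F \<alpha>)"
  shows "Ob x \<in> Obj H"
  using V_hom[OF assms(1), of "Triv x"] assms hom_Obj by auto

lemma V_triv:
  assumes "\<alpha> \<in> I" "x \<in> Elems (F \<alpha>)"
  shows "V \<alpha> (Triv x) = Ident H (Ob x)"
proof -
  note l = link[OF assms]
  have "theta \<alpha> (link \<alpha> x) \<in> hom (ob (source (link \<alpha> x))) (Ob x)"
    using theta_hom[OF assms(1), of "link \<alpha> x"] l by simp
  then show ?thesis
    using l assms Ob_Obj[OF assms] ident_left ident_hom
    by (intro V_unique[OF assms(1), of _ "link \<alpha> x"]) simp_all
qed

lemma V_comp:
  assumes "\<alpha> \<in> I" "wk \<alpha> u" "wk \<alpha> v" "source u = terminal v"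
  shows "V \<alpha> (wcomp u v) = V \<alpha> u \<bullet> V \<alpha> v"
proof -
  let ?q = "link \<alpha> (source v)"
  note l = link[OF assms(1) wk_Elems(1)[OF assms(3)]]
  have h: "V \<alpha> u \<in> hom (Ob (terminal v)) (Ob (terminal u))" "V \<alpha> v \<in> hom (Ob (source v)) (Ob (terminal v))"
    using V_hom[OF assms(1)] assms by metis+
  have q: "theta \<alpha> ?q \<in> hom (ob (source ?q)) (Ob (source v))"
    using theta_hom[OF assms(1), of ?q] l by simp
  have "theta \<alpha> (wcomp (wcomp u v) ?q) = V \<alpha> u \<bullet> theta \<alpha> (wcomp v ?q)"
    using theta_wcomp[OF assms(1,2), of "wcomp v ?q"] assms l by simp
  also have "theta \<alpha> (wcomp v ?q) = V \<alpha> v \<bullet> theta \<alpha> ?q"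
    using theta_wcomp[OF assms(1,3), of ?q] l by simp
  also have "V \<alpha> u \<bullet> V \<alpha> v \<bullet> theta \<alpha> ?q = (V \<alpha> u \<bullet> V \<alpha> v) \<bullet> theta \<alpha> ?q"
    using comp_assoc[OF h q] by simp
  finally show ?thesis
    using assms l h by (intro V_unique[of _ _ ?q]) auto
qed

lemma V_homotopic:
  assumes "\<alpha> \<in> I" "homotopic G g (F \<alpha>) u v"
  shows "V \<alpha> u = V \<alpha> v"
proof -
  note E = frac_brauer.homotopic_imp_walk[OF frac[OF assms(1)] assms(2)]
  let ?q = "link \<alpha> (source v)"
  have v: "wk \<alpha> v" using E by simp
  note l = link[OF assms(1) wk_Elems(1)[OF v]]
  have "theta \<alpha> (wcomp u ?q) = theta \<alpha> (wcomp v ?q)"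
    using assms E l by (intro theta_homotopic homotopic.h5_right) simp_all
  then show ?thesis unfolding V_def using E by simp
qed

text \<open>A walk \<open>q\<close> from \<open>A\<close> in both members gives the same
  \<open>theta\<close> on \<open>q\<close> and on \<open>wcomp w q\<close> in either of them, and
  these two values determine \<open>V\<close>.\<close>

lemma V_common:
  assumes "\<alpha> \<in> I" "\<beta> \<in> I" "wk \<alpha> w" "wk \<beta> w"
  shows "V \<alpha> w = V \<beta> w"
proof -
  obtain q where q: "anch \<alpha> q" "anch \<beta> q" "terminal q = source w"
    using common2[OF assms(1,2) wk_Elems(1)[OF assms(3)] wk_Elems(1)[OF assms(4)]] .
  have "theta \<alpha> (wcomp w q) = V \<beta> w \<bullet> theta \<alpha> q"
    using theta_wcomp[OF assms(2,4) q(2,3)] theta_common[OF assms(1,2) q(1,2)]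
      theta_common[OF assms(1,2), of "wcomp w q"] q assms by simp
  then show ?thesis
    using V_unique[OF assms(1,3) q(1,3) V_hom[OF assms(2,4)]] by simp
qed

lemma V_A:
  assumes "\<alpha> \<in> I" "wk \<alpha> w" "source w \<in> A" "terminal w \<in> A"
  shows "V \<alpha> w = f \<alpha> w"
proof -
  have t: "wk \<alpha> (Triv (source w))" using wk_Elems[OF assms(2)] by simp
  have fw: "f \<alpha> w \<in> hom (Ob (source w)) (Ob (terminal w))"
    using f_hom[OF assms] assms by (simp add: Ob_A)
  have "theta \<alpha> w = f \<alpha> w \<bullet> theta \<alpha> (Triv (source w))"
    using theta_A[OF assms(1), of w] theta_A[OF assms(1), of "Triv (source w)"] assms t fw
    by (simp add: f_triv ident_right Ob_A)
  then show ?thesis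
    using V_unique[OF assms(1,2) _ _ fw, of "Triv (source w)"] t assms by simp
qed

end

section \<open>Admissible unions\<close>

locale admissible = frac_brauer G g E for G :: "'g monoid" and g :: 'g
    and E :: "('g, 'e) fbc_data" +
  fixes I :: "'i set" and F :: "'i \<Rightarrow> ('g, 'e) fbc_data"
  assumes adm: "admissible_union G g E I F"
begin

lemma sub_family: "\<alpha> \<in> I \<Longrightarrow> sub_frac_brauer G g E (F \<alpha>)"
  using adm frac_brauer_axioms
  by (intro sub_frac_brauer.intro sub_frac_brauer_axioms.intro) (simp_all add: admissible_union_def)

lemma frac_family: "\<alpha> \<in> I \<Longrightarrow> frac_brauer G g (F \<alpha>)"
  using sub_frac_brauer.sub[OF sub_family] group_G g_carrier
  by (intro frac_brauer.intro) (auto simp: sub_fbc_def)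

lemma union_eq: "fbc_eq G E (fbc_union E I F)"
  using adm by (simp add: admissible_union_def)

lemma Elems_union: "Elems E = (\<Union>\<alpha>\<in>I. Elems (F \<alpha>))"
  using union_eq by (simp add: fbc_eq_def fbc_union_def)

lemma Act_family: "\<alpha> \<in> I \<Longrightarrow> x \<in> carrier G \<Longrightarrow> e \<in> Elems (F \<alpha>) \<Longrightarrow> Act (F \<alpha>) x e = Act E x e"
  using sub_frac_brauer.sub_Act[OF sub_family] .

lemma is_step_family:
  assumes "\<alpha> \<in> I" "e \<in> Elems (F \<alpha>)" "\<delta> \<noteq> Tau"
  shows "is_step G g (F \<alpha>) e' \<delta> e \<longleftrightarrow> is_step G g E e' \<delta> e"
  using assms by (cases \<delta>) (simp_all add: Act_family)

lemma Pcl_inter: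
  assumes "\<gamma> \<in> I" "fbc_eq G (F \<gamma>) (fbc_inter E J F)" "x \<in> Elems (F \<gamma>)" "J \<subseteq> I"
  shows "Pcl (F \<gamma>) x = (\<Inter>\<alpha>\<in>J. Pcl (F \<alpha>) x)"
    and "Lcl (F \<gamma>) x = (\<Inter>\<alpha>\<in>J. Lcl (F \<alpha>) x)"
proof -
  have el: "Elems (F \<gamma>) = (\<Inter>\<alpha>\<in>J. Elems (F \<alpha>))"
    and pp: "PPart (F \<gamma>) = inter_partition J (\<lambda>\<alpha>. Elems (F \<alpha>)) (\<lambda>\<alpha>. PPart (F \<alpha>))"
    and ll: "LPart (F \<gamma>) = inter_partition J (\<lambda>\<alpha>. Elems (F \<alpha>)) (\<lambda>\<alpha>. LPart (F \<alpha>))"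
    using assms(2) by (simp_all add: fbc_eq_def fbc_inter_def)
  have mem: "x \<in> Pcl (F \<alpha>) x" "x \<in> Lcl (F \<alpha>) x" if "\<alpha> \<in> J" for \<alpha>
    using that assms(3,4) el block_mem(2)[OF frac_brauer.partP[OF frac_family]]
      block_mem(2)[OF frac_brauer.partL[OF frac_family]] by auto
  show "Pcl (F \<gamma>) x = (\<Inter>\<alpha>\<in>J. Pcl (F \<alpha>) x)"
  proof (rule block_unique[OF frac_brauer.partP[OF frac_family[OF assms(1)]]])
    show "(\<Inter>\<alpha>\<in>J. Pcl (F \<alpha>) x) \<in> PPart (F \<gamma>)"
      using assms(3) el unfolding pp inter_partition_def by blast
  qed (use mem in blast)
  show "Lcl (F \<gamma>) x = (\<Inter>\<alpha>\<in>J. Lcl (F \<alpha>) x)"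
  proof (rule block_unique[OF frac_brauer.partL[OF frac_family[OF assms(1)]]])
    show "(\<Inter>\<alpha>\<in>J. Lcl (F \<alpha>) x) \<in> LPart (F \<gamma>)"
      using assms(3) el unfolding ll inter_partition_def by blast
  qed (use mem in blast)
qed

text \<open>The last conclusion goes upward, from the members to their intersection: a \<tau>-step
  of every member in \<open>J\<close> is one of the intersection, because its P-classes are the
  intersections of theirs. It makes a walk shared by two members comparable inside the
  diagram.\<close>

lemma finite_inter:
  assumes "finite J" "J \<noteq> {}" "J \<subseteq> I"
  obtains \<gamma> where "\<gamma> \<in> I" "Elems (F \<gamma>) = (\<Inter>\<alpha>\<in>J. Elems (F \<alpha>))"
    and "\<And>\<alpha>. \<alpha> \<in> J \<Longrightarrow> sub_fbc G g (F \<gamma>) (F \<alpha>)"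
    and "\<And>w. (\<And>\<alpha>. \<alpha> \<in> J \<Longrightarrow> is_walk G g (F \<alpha>) w) \<Longrightarrow> is_walk G g (F \<gamma>) w"
proof -
  obtain \<gamma> where \<gamma>: "\<gamma> \<in> I" "fbc_eq G (F \<gamma>) (fbc_inter E J F)"
    using adm assms unfolding admissible_union_def by meson
  have el: "Elems (F \<gamma>) = (\<Inter>\<alpha>\<in>J. Elems (F \<alpha>))"
    using \<gamma>(2) by (simp add: fbc_eq_def fbc_inter_def)
  note cl = Pcl_inter[OF \<gamma> _ assms(3)]
  show thesis
  proof (rule that[OF \<gamma>(1) el])
    fix \<alpha> assume \<alpha>: "\<alpha> \<in> J"
    then have "\<alpha> \<in> I" using assms by blast
    have sub: "Elems (F \<gamma>) \<subseteq> Elems (F \<alpha>)" using el \<alpha> by blast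
    have "Deg (F \<alpha>) e = Deg (F \<gamma>) e" if "e \<in> Elems (F \<gamma>)" for e
      using that sub sub_frac_brauer.sub_Deg[OF sub_family[OF \<gamma>(1)]]
        sub_frac_brauer.sub_Deg[OF sub_family[OF \<open>\<alpha> \<in> I\<close>]] by auto
    moreover have "Act (F \<gamma>) x e = Act (F \<alpha>) x e" if "x \<in> carrier G" "e \<in> Elems (F \<gamma>)" for x e
      using that sub Act_family[OF \<gamma>(1)] Act_family[OF \<open>\<alpha> \<in> I\<close>] by auto
    moreover have "Pcl (F \<gamma>) e \<subseteq> Pcl (F \<alpha>) e" "Lcl (F \<gamma>) e \<subseteq> Lcl (F \<alpha>) e" if "e \<in> Elems (F \<gamma>)" for e
      using cl[OF that] \<alpha> by blast+
    ultimately show "sub_fbc G g (F \<gamma>) (F \<alpha>)"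
      using sub frac_brauer.is_fbc[OF frac_family[OF \<gamma>(1)]]
      by (simp add: sub_fbc_def fbc_morphism_def)
  next
    fix w assume "\<And>\<alpha>. \<alpha> \<in> J \<Longrightarrow> is_walk G g (F \<alpha>) w"
    then show "is_walk G g (F \<gamma>) w"
    proof (induction w)
      case (Triv x)
      then show ?case using el by simp
    next
      case (Step e \<delta> w)
      then have w: "is_walk G g (F \<gamma>) w" by simp
      have e: "e \<in> Elems (F \<gamma>)" "terminal w \<in> Elems (F \<gamma>)"
        using Step.prems el walk_Elems(2)[OF w] by simp_all
      obtain \<alpha> where \<alpha>: "\<alpha> \<in> J" "\<alpha> \<in> I" "terminal w \<in> Elems (F \<alpha>)"
        using assms e(2) el by blast
      have "is_step G g (F \<gamma>) e \<delta> (terminal w)"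
      proof (cases "\<delta> = Tau")
        case True
        have "Pcl (F \<alpha>) e = Pcl (F \<alpha>) (terminal w)" if "\<alpha> \<in> J" for \<alpha>
          using Step.prems[OF that] True by simp
        then show ?thesis using True cl(1)[OF e(1)] cl(1)[OF e(2)] by simp
      next
        case False
        then show ?thesis
          using Step.prems[OF \<alpha>(1)] is_step_family[OF \<alpha>(2,3)] is_step_family[OF \<gamma>(1) e(2)] by simp
      qed
      then show ?case using e w by simp
    qed
  qed
qed

section \<open>Edge paths of the local complexes\<close>

definition adj :: "'e \<Rightarrow> 'e \<Rightarrow> bool" where
  "adj x y \<longleftrightarrow> (\<exists>\<alpha>\<in>I. x \<in> Elems (F \<alpha>) \<and> y \<in> Elems (F \<alpha>) \<and> Pcl (F \<alpha>) x = Pcl (F \<alpha>) y)"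

definition Ladj :: "'e \<Rightarrow> 'e \<Rightarrow> bool" where
  "Ladj x y \<longleftrightarrow> (\<exists>\<alpha>\<in>I. x \<in> Elems (F \<alpha>) \<and> y \<in> Elems (F \<alpha>) \<and> Lcl (F \<alpha>) x = Lcl (F \<alpha>) y)"

text \<open>An edge path of K_e with no mention of e: neighbours share a P-class of
  \<open>E\<close>, so a chain never leaves the class of its head
  (\<open>chain_Pcl\<close>).\<close>

definition chain :: "'e list \<Rightarrow> bool" where
  "chain xs \<longleftrightarrow> xs \<noteq> [] \<and> set xs \<subseteq> Elems E \<and> successively adj xs"

lemma adj_Pcl: "adj x y \<Longrightarrow> Pcl E x = Pcl E y"
  using sub_frac_brauer.sub_Pcl_eq[OF sub_family] unfolding adj_def by blast

lemma adj_Elems: "adj x y \<Longrightarrow> x \<in> Elems E \<and> y \<in> Elems E"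
  using Elems_union unfolding adj_def by blast

lemma chain_Cons [simp]: "chain (x # y # ys) \<longleftrightarrow> adj x y \<and> chain (y # ys)"
  using adj_Elems unfolding chain_def by auto

lemma chain_single [simp]: "chain [x] \<longleftrightarrow> x \<in> Elems E"
  by (simp add: chain_def)

lemma chain_Nil [simp]: "\<not> chain []"
  by (simp add: chain_def)

lemma chain_append: "chain xs \<Longrightarrow> chain ys \<Longrightarrow> last xs = hd ys \<Longrightarrow> chain (xs @ tl ys)"
proof (induction xs rule: induct_list012)
  case (2 x)
  then show ?case by (cases ys) auto
qed auto

lemma chain_Pcl: "chain xs \<Longrightarrow> x \<in> set xs \<Longrightarrow> Pcl E x = Pcl E (hd xs)"
proof (induction xs rule: induct_list012)
  case (3 y z zs)
  then show ?case using adj_Pcl[of y z] by auto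
qed auto

text \<open>Simplices are the nonempty subsets of classes of members, so sharing a simplex means
  sharing such a class; conversely the class itself is a simplex.\<close>

lemma adj_local_complex:
  assumes "e \<in> Elems E" "x \<in> Pcl E e"
  shows "(\<exists>S\<in>local_complex E I F e. x \<in> S \<and> y \<in> S) \<longleftrightarrow> adj x y"
proof
  assume "\<exists>S\<in>local_complex E I F e. x \<in> S \<and> y \<in> S"
  then obtain \<alpha> h where h: "\<alpha> \<in> I" "h \<in> Elems (F \<alpha>)" "x \<in> Pcl (F \<alpha>) h" "y \<in> Pcl (F \<alpha>) h"
    unfolding local_complex_def by blast
  note p = frac_brauer.partP[OF frac_family[OF h(1)]]
  show "adj x y"
    unfolding adj_def
    using h block_mem(3)[OF p h(2)] block_eqI[OF p h(2)] by (intro bexI[of _ \<alpha>]) auto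
next
  assume "adj x y"
  then obtain \<alpha> where \<alpha>: "\<alpha> \<in> I" "x \<in> Elems (F \<alpha>)" "y \<in> Elems (F \<alpha>)" "Pcl (F \<alpha>) x = Pcl (F \<alpha>) y"
    unfolding adj_def by blast
  note p = frac_brauer.partP[OF frac_family[OF \<alpha>(1)]]
  have "x \<in> Pcl (F \<alpha>) x" "y \<in> Pcl (F \<alpha>) x"
    using block_mem(2)[OF p] \<alpha> by auto
  then show "\<exists>S\<in>local_complex E I F e. x \<in> S \<and> y \<in> S"
    unfolding local_complex_def using \<alpha> assms by (intro bexI[of _ "Pcl (F \<alpha>) x"]) auto
qed

lemma simp_walk_iff_chain:
  assumes "e \<in> Elems E"
  shows "simp_walk (Pcl E e) (local_complex E I F e) xs \<longleftrightarrow> chain xs \<and> hd xs \<in> Pcl E e"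
proof
  assume w: "simp_walk (Pcl E e) (local_complex E I F e) xs"
  then have s: "set xs \<subseteq> Pcl E e" "xs \<noteq> []" by (auto simp: simp_walk_def)
  have "successively adj xs"
  proof (rule successively_mono)
    show "successively (\<lambda>x y. \<exists>S\<in>local_complex E I F e. x \<in> S \<and> y \<in> S) xs"
      using w by (simp add: simp_walk_def)
    show "adj x y" if "x \<in> set xs" "\<exists>S\<in>local_complex E I F e. x \<in> S \<and> y \<in> S" for x y
      using that s(1) adj_local_complex[OF assms] by blast
  qed
  then show "chain xs \<and> hd xs \<in> Pcl E e"
    using s Pcl_Elems(2)[OF assms] by (auto simp: chain_def)
next
  assume c: "chain xs \<and> hd xs \<in> Pcl E e"
  then have x: "xs \<noteq> []" "hd xs \<in> Elems E" "set xs \<subseteq> Elems E"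
    using Pcl_Elems(2)[OF assms] by (auto simp: chain_def)
  have s: "set xs \<subseteq> Pcl E e"
  proof
    fix x assume "x \<in> set xs"
    then show "x \<in> Pcl E e"
      using chain_Pcl[of xs x] c x Pcl_eq_iff[OF assms, of x] Pcl_eq_iff[OF assms, of "hd xs"] by auto
  qed
  have "successively (\<lambda>x y. \<exists>S\<in>local_complex E I F e. x \<in> S \<and> y \<in> S) xs"
  proof (rule successively_mono)
    show "successively adj xs" using c by (simp add: chain_def)
    show "\<exists>S\<in>local_complex E I F e. x \<in> S \<and> y \<in> S" if "x \<in> set xs" "adj x y" for x y
      using that s adj_local_complex[OF assms] by blast
  qed
  then show "simp_walk (Pcl E e) (local_complex E I F e) xs"
    using s x by (simp add: simp_walk_def)
qed

lemma simply_connected: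
  "e \<in> Elems E \<Longrightarrow> simply_connected_complex (Pcl E e) (local_complex E I F e)"
  using adm by (simp add: admissible_union_def)

lemma chain_exists:
  assumes "x \<in> Elems E" "y \<in> Elems E" "Pcl E x = Pcl E y"
  obtains xs where "chain xs" "hd xs = x" "last xs = y"
proof -
  have "x \<in> Pcl E x" "y \<in> Pcl E x" using assms Pcl_Elems(1) by auto
  then show thesis
    using simply_connected[OF assms(1)] that simp_walk_iff_chain[OF assms(1)]
    unfolding simply_connected_complex_def by blast
qed

text \<open>This is where \<open>E\<close> being the union as an f-BC is used for L: the relation on
  \<open>E\<close> is generated by those of the members. No complex is involved.\<close>

lemma Lcl_chain:
  assumes "x \<in> Elems E" "y \<in> Elems E" "Lcl E x = Lcl E y"
  obtains xs where "xs \<noteq> []" "successively Ladj xs" "hd xs = x" "last xs = y"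
proof -
  let ?R = "\<lambda>e h. \<exists>\<alpha>\<in>I. e \<in> Elems (F \<alpha>) \<and> h \<in> Elems (F \<alpha>) \<and> Lcl (F \<alpha>) e = Lcl (F \<alpha>) h"
  have L: "LPart E = (\<Union>\<alpha>\<in>I. Elems (F \<alpha>)) // {(e, h). equivclp ?R e h}"
    using union_eq by (simp add: fbc_eq_def fbc_union_def union_partition_def)
  have "{(e, h). equivclp ?R e h} `` {x} \<in> LPart E"
    unfolding L using assms(1) Elems_union by (blast intro: quotientI)
  then have "Lcl E x = {(e, h). equivclp ?R e h} `` {x}"
    by (rule block_unique[OF partL]) auto
  moreover have "y \<in> Lcl E x" using block_mem(2)[OF partL assms(2)] assms(3) by simp
  ultimately have "equivclp ?R x y" by simp
  \<comment> \<open>The generating relation is already symmetric, so the generated equivalence is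
    the reflexive transitive closure of \<open>Ladj\<close>.\<close>
  moreover have "symclp ?R = Ladj" by (auto simp: symclp_def Ladj_def fun_eq_iff)
  ultimately have "Ladj\<^sup>*\<^sup>* x y" by (simp add: equivclp_def)
  then have "\<exists>xs. xs \<noteq> [] \<and> successively Ladj xs \<and> hd xs = x \<and> last xs = y"
  proof (induction rule: converse_rtranclp_induct)
    case base
    show ?case by (intro exI[of _ "[y]"]) simp
  next
    case (step x z)
    then obtain xs where "xs \<noteq> []" "successively Ladj xs" "hd xs = z" "last xs = y" by blast
    then show ?case using step(1) by (intro exI[of _ "x # xs"]) (cases xs; simp)
  qed
  then show thesis using that by blast
qed

end

section \<open>The value of a walk of the union\<close>

locale admissible_functors = admissible G g E I F + local_functors H G g I F A ob f
  for G :: "'g monoid" and g :: 'g and E :: "('g, 'e) fbc_data"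
    and I :: "'i set" and F :: "'i \<Rightarrow> ('g, 'e) fbc_data"
    and H :: "('p, 'n) gpd" and A :: "'e set"
    and ob :: "'e \<Rightarrow> 'p" and f :: "'i \<Rightarrow> 'e walk \<Rightarrow> 'n"
begin

lemma Ob_E: "x \<in> Elems E \<Longrightarrow> Ob x \<in> Obj H"
  using Elems_union Ob_Obj by blast

section \<open>Values of edge paths\<close>

definition jump :: "'e \<Rightarrow> 'e \<Rightarrow> 'n" where
  "jump x y = V (SOME \<alpha>. \<alpha> \<in> I \<and> x \<in> Elems (F \<alpha>) \<and> y \<in> Elems (F \<alpha>) \<and> Pcl (F \<alpha>) x = Pcl (F \<alpha>) y)
     (edge y Tau x)"

lemma jump_eq:
  assumes "\<alpha> \<in> I" "x \<in> Elems (F \<alpha>)" "y \<in> Elems (F \<alpha>)" "Pcl (F \<alpha>) x = Pcl (F \<alpha>) y"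
  shows "jump x y = V \<alpha> (edge y Tau x)"
proof -
  have "\<exists>\<alpha>. \<alpha> \<in> I \<and> x \<in> Elems (F \<alpha>) \<and> y \<in> Elems (F \<alpha>) \<and> Pcl (F \<alpha>) x = Pcl (F \<alpha>) y"
    using assms by blast
  from someI_ex[OF this] show ?thesis
    unfolding jump_def using assms by (intro V_common) simp_all
qed

lemma jump_hom: "adj x y \<Longrightarrow> jump x y \<in> hom (Ob x) (Ob y)"
  unfolding adj_def using jump_eq V_hom[of _ "edge y Tau x"] by auto

text \<open>Lists run from source to target while arrows compose from right to left, hence the
  reversed order. The empty list is not a chain, so its value is arbitrary.\<close>

fun sval :: "'e list \<Rightarrow> 'n" where
  "sval [] = undefined"
| "sval [x] = Ident H (Ob x)"
| "sval (x # y # ys) = sval (y # ys) \<bullet> jump x y"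

lemma sval_hom: "chain xs \<Longrightarrow> sval xs \<in> hom (Ob (hd xs)) (Ob (last xs))"
proof (induction xs rule: induct_list012)
  case (2 x)
  then show ?case using Ob_E by auto
next
  case (3 x y zs)
  then show ?case using jump_hom[of x y] by auto
qed simp

lemma sval_append:
  "chain xs \<Longrightarrow> chain ys \<Longrightarrow> last xs = hd ys \<Longrightarrow> sval (xs @ tl ys) = sval ys \<bullet> sval xs"
proof (induction xs rule: induct_list012)
  case (2 x)
  then have "sval ys \<in> hom (Ob x) (Ob (last ys))" "x # tl ys = ys"
    using sval_hom[of ys] by (simp_all, cases ys, simp_all)
  then show ?case using ident_right by simp
next
  case (3 x y zs)
  then have "sval (y # zs @ tl ys) = sval ys \<bullet> sval (y # zs)" by simp
  then show ?case
    using comp_assoc[of "sval ys" _ _ "sval (y # zs)" _ "jump x y"]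
      sval_hom[of ys] sval_hom[of "y # zs"] jump_hom[of x y] 3 by simp
qed simp

lemma jump_triangle:
  assumes "\<alpha> \<in> I" "x \<in> Elems (F \<alpha>)" "y \<in> Elems (F \<alpha>)" "z \<in> Elems (F \<alpha>)"
    and "Pcl (F \<alpha>) x = Pcl (F \<alpha>) y" "Pcl (F \<alpha>) y = Pcl (F \<alpha>) z"
  shows "jump y z \<bullet> jump x y = jump x z"
proof -
  have "jump y z \<bullet> jump x y = V \<alpha> (wcomp (edge z Tau y) (edge y Tau x))"
    using assms jump_eq[of \<alpha>] V_comp[OF assms(1), of "edge z Tau y" "edge y Tau x"] by simp
  also have "\<dots> = V \<alpha> (edge z Tau x)"
    using assms by (intro V_homotopic homotopic.h2) simp_all
  also have "\<dots> = jump x z" using assms jump_eq by simp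
  finally show ?thesis .
qed

lemma jump_self:
  assumes "x \<in> Elems E"
  shows "jump x x = Ident H (Ob x)"
proof -
  obtain \<alpha> where \<alpha>: "\<alpha> \<in> I" "x \<in> Elems (F \<alpha>)" using assms Elems_union by blast
  then show ?thesis
    using jump_eq[OF \<alpha> \<alpha>(2)] V_homotopic[OF \<alpha>(1) homotopic.h1_tau[OF \<alpha>(2)]] V_triv by simp
qed

text \<open>A triangle lies in one class of one member, where (h2) gives
  \<open>jump_triangle\<close>; a repeated point is (h1). The chain and endpoint facts are carried
  through the induction because \<open>sval_append\<close> needs them in the composition
  case.\<close>

lemma sval_homotopic:
  assumes "e \<in> Elems E" "simp_homotopic (Pcl E e) (local_complex E I F e) xs ys"
  shows "chain xs \<and> chain ys \<and> hd xs = hd ys \<and> last xs = last ys \<and>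
    hd xs \<in> Pcl E e \<and> sval xs = sval ys"
  using assms(2)
proof induction
  case (refl xs)
  then show ?case using simp_walk_iff_chain[OF assms(1)] by simp
next
  case (triangle S x0 x1 x2)
  then obtain \<alpha> h where h: "\<alpha> \<in> I" "h \<in> Elems (F \<alpha>)" "h \<in> Pcl E e" "S \<subseteq> Pcl (F \<alpha>) h"
    unfolding local_complex_def by blast
  interpret s: sub_frac_brauer G g E "F \<alpha>" by (rule sub_family[OF h(1)])
  have x: "x \<in> Elems (F \<alpha>) \<and> Pcl (F \<alpha>) x = Pcl (F \<alpha>) h" if "x \<in> S" for x
    using that h(2,4) block_mem(3)[OF s.K.partP h(2)] block_eqI[OF s.K.partP h(2)] by blast
  have xs: "x0 \<in> Elems (F \<alpha>)" "x1 \<in> Elems (F \<alpha>)" "x2 \<in> Elems (F \<alpha>)"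
    "Pcl (F \<alpha>) x0 = Pcl (F \<alpha>) x1" "Pcl (F \<alpha>) x1 = Pcl (F \<alpha>) x2"
    using x triangle by auto
  have adjs: "adj x0 x1" "adj x1 x2" "adj x0 x2" using xs h(1) unfolding adj_def by auto
  have "Pcl E x0 = Pcl E e"
    using s.sub_Pcl_eq[OF xs(1) h(2)] x triangle(2) h(2,3) Pcl_eq_iff[OF assms(1), of h] by simp
  then have "x0 \<in> Pcl E e" using xs(1) Pcl_Elems(1)[of x0] by simp
  moreover have "sval [x0, x1, x2] = sval [x0, x2]"
    using jump_triangle[OF h(1) xs] jump_hom[OF adjs(2)] jump_hom[OF adjs(3)]
      comp_assoc[OF _ jump_hom[OF adjs(2)] jump_hom[OF adjs(1)], of "Ident H (Ob x2)"]
      ident_left[OF jump_hom[OF adjs(2)]] ident_left[OF jump_hom[OF adjs(3)]] by simp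
  ultimately show ?case using adjs adj_Elems by auto
next
  case (point x)
  have "x \<in> Elems E" using point Pcl_Elems(2)[OF assms(1)] by blast
  moreover then have "adj x x" using Elems_union unfolding adj_def by blast
  ultimately show ?case
    using point jump_self ident_right[OF ident_hom[OF Ob_E]] by simp
next
  case (comp xs xs' ys ys')
  have "xs \<noteq> []" "xs' \<noteq> []" "ys \<noteq> []" "ys' \<noteq> []"
    using comp.IH by (auto simp: chain_def)
  moreover from this have "last (xs @ tl ys) = last ys" "last (xs' @ tl ys') = last ys'"
    using comp by (auto simp: last_append last_tl) (metis last_ConsL list.collapse)+
  ultimately show ?case
    using comp chain_append[of xs ys] chain_append[of xs' ys'] sval_append[of xs ys] sval_append[of xs' ys']
    by auto
qed auto

lemma sval_closed:
  assumes "chain xs" "hd xs = last xs"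
  shows "sval xs = Ident H (Ob (hd xs))"
proof -
  let ?x = "hd xs" and ?X = "Pcl E (hd xs)" and ?K = "local_complex E I F (hd xs)"
  have x: "?x \<in> Elems E" "?x \<in> ?X"
    using assms Pcl_Elems(1)[of ?x] by (cases xs; auto simp: chain_def)+
  have "simp_walk ?X ?K xs" "simp_walk ?X ?K [?x]"
    using simp_walk_iff_chain[OF x(1)] assms x by simp_all
  then have c: "{ys. simp_homotopic ?X ?K xs ys} \<in> simp_pi1 ?X ?K ?x"
    "{ys. simp_homotopic ?X ?K [?x] ys} \<in> simp_pi1 ?X ?K ?x"
    using assms(2) unfolding simp_pi1_def quotient_def by (auto intro!: bexI)
  have "is_singleton (simp_pi1 ?X ?K ?x)"
    using simply_connected[OF x(1)] x(2) unfolding simply_connected_complex_def by blast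
  then obtain C where C: "simp_pi1 ?X ?K ?x = {C}" by (auto elim: is_singletonE)
  \<comment> \<open>Both classes are elements of the one-element set \<open>simp_pi1\<close>; since
    \<open>xs\<close> lies in its own class, it is homotopic to the trivial walk.\<close>
  have "{ys. simp_homotopic ?X ?K xs ys} = {ys. simp_homotopic ?X ?K [?x] ys}"
    using c[unfolded C] by simp
  moreover have "simp_homotopic ?X ?K xs xs"
    using \<open>simp_walk ?X ?K xs\<close> by (rule simp_homotopic.refl)
  ultimately have "simp_homotopic ?X ?K [?x] xs" by blast
  then have "sval [?x] = sval xs" using sval_homotopic[OF x(1)] by blast
  then show ?thesis by simp
qed

lemma sval_unique:
  assumes "chain xs" "chain ys" "hd xs = hd ys" "last xs = last ys"
  shows "sval xs = sval ys"
proof -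
  have x: "hd xs \<in> Elems E" "last xs \<in> Elems E" "last xs \<in> set xs"
    using assms(1) by (cases xs; auto simp: chain_def)+
  have "Pcl E (last xs) = Pcl E (hd xs)" using chain_Pcl[OF assms(1) x(3)] .
  \<comment> \<open>A return path: preceding either of the two chains by \<open>zs\<close> gives a
    closed chain, and the invertible factor \<open>sval zs\<close> is then cancelled.\<close>
  then obtain zs where zs: "chain zs" "hd zs = last xs" "last zs = hd xs"
    using chain_exists[OF x(2,1)] by blast
  have *: "sval us \<bullet> sval zs = Ident H (Ob (last xs))"
    if "chain us" "hd us = hd xs" "last us = last xs" for us
  proof -
    have "last (zs @ tl us) = last us"
      using that zs by (cases us; cases zs) (auto simp: last_append)
    moreover have "hd (zs @ tl us) = hd zs" using zs(1) by (cases zs) auto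
    ultimately show ?thesis
      using sval_append[OF zs(1) that(1)] chain_append[OF zs(1) that(1)] sval_closed[of "zs @ tl us"]
        that zs by simp
  qed
  have "sval xs \<in> hom (Ob (hd xs)) (Ob (last xs))" "sval ys \<in> hom (Ob (hd xs)) (Ob (last xs))"
    "sval zs \<in> hom (Ob (last xs)) (Ob (hd xs))"
    using sval_hom[OF assms(1)] sval_hom[OF assms(2)] sval_hom[OF zs(1)] assms(3,4) zs by simp_all
  then show ?thesis using *[OF assms(1)] *[OF assms(2)] assms(3,4) cancel_right by simp
qed

section \<open>Values of steps and walks of the union\<close>

definition tauval :: "'e \<Rightarrow> 'e \<Rightarrow> 'n" where
  "tauval x y = sval (SOME xs. chain xs \<and> hd xs = x \<and> last xs = y)"

lemma tauval_eq:
  assumes "chain xs"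
  shows "tauval (hd xs) (last xs) = sval xs"
proof -
  have "\<exists>ys. chain ys \<and> hd ys = hd xs \<and> last ys = last xs" using assms by blast
  from someI_ex[OF this] show ?thesis
    unfolding tauval_def using assms by (intro sval_unique) simp_all
qed

lemma tauval_adj:
  assumes "adj x y"
  shows "tauval x y = jump x y"
  using tauval_eq[of "[x, y]"] assms adj_Elems[OF assms] ident_left[OF jump_hom[OF assms]] by simp

lemma tauval_hom:
  assumes "x \<in> Elems E" "y \<in> Elems E" "Pcl E x = Pcl E y"
  shows "tauval x y \<in> hom (Ob x) (Ob y)"
proof -
  obtain xs where "chain xs" "hd xs = x" "last xs = y" using chain_exists[OF assms] .
  then show ?thesis using tauval_eq[of xs] sval_hom[of xs] by simp
qed

text \<open>A g-step from \<open>e\<close> stays in every member containing \<open>e\<close>, by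
  invariance, so \<open>home e\<close> is as good as any other. A \<tau>-step of \<open>E\<close>
  need not lie in any member and has to be evaluated along a chain.\<close>

definition ev :: "'e \<Rightarrow> letter \<Rightarrow> 'e \<Rightarrow> 'n" where
  "ev e' \<delta> e = (if \<delta> = Tau then tauval e e' else V (home e) (edge e' \<delta> e))"

fun val :: "'e walk \<Rightarrow> 'n" where
  "val (Triv e) = Ident H (Ob e)"
| "val (Step e \<delta> w) = ev e \<delta> (terminal w) \<bullet> val w"

lemma ev_local:
  assumes "\<alpha> \<in> I" "e \<in> Elems (F \<alpha>)" "e' \<in> Elems (F \<alpha>)" "is_step G g (F \<alpha>) e' \<delta> e"
  shows "ev e' \<delta> e = V \<alpha> (edge e' \<delta> e)"
proof (cases "\<delta> = Tau")
  case True
  then have "adj e e'" using assms unfolding adj_def by auto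
  then show ?thesis
    using True tauval_adj jump_eq[OF assms(1-3)] assms(4) by (simp add: ev_def)
next
  case False
  note h = home[OF assms(1,2)]
  have s: "is_step G g (F (home e)) e' \<delta> e"
    using assms False is_step_family[OF assms(1,2)] is_step_family[OF h] by simp
  have "e' \<in> Elems (F (home e))"
    using frac_brauer.is_step_Elems[OF frac[OF h(1)] s False h(2)] .
  then show ?thesis
    using False V_common[OF h(1) assms(1), of "edge e' \<delta> e"] assms h s by (simp add: ev_def)
qed

lemma val_local:
  assumes "\<alpha> \<in> I"
  shows "wk \<alpha> w \<Longrightarrow> val w = V \<alpha> w"
proof (induction w)
  case (Triv x)
  then show ?case using V_triv[OF assms] by simp
next
  case (Step e \<delta> w)
  then have w: "wk \<alpha> w" "e \<in> Elems (F \<alpha>)" "is_step G g (F \<alpha>) e \<delta> (terminal w)" "terminal w \<in> Elems (F \<alpha>)"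
    using wk_Elems(2)[of \<alpha> w] by auto
  then show ?case
    using Step.IH ev_local[OF assms w(4,2,3)] V_comp[OF assms, of "edge e \<delta> (terminal w)" w] by simp
qed

lemma ev_hom:
  assumes "e \<in> Elems E" "e' \<in> Elems E" "is_step G g E e' \<delta> e"
  shows "ev e' \<delta> e \<in> hom (Ob e) (Ob e')"
proof (cases "\<delta> = Tau")
  case True
  then show ?thesis using tauval_hom[OF assms(1,2)] assms(3) by (simp add: ev_def)
next
  case False
  obtain \<alpha> where \<alpha>: "\<alpha> \<in> I" "e \<in> Elems (F \<alpha>)" using assms(1) Elems_union by blast
  note h = home[OF \<alpha>]
  have s: "is_step G g (F (home e)) e' \<delta> e"
    using assms(3) False is_step_family[OF h] by simp
  have "e' \<in> Elems (F (home e))"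
    using frac_brauer.is_step_Elems[OF frac[OF h(1)] s False h(2)] .
  then show ?thesis
    using False V_hom[OF h(1), of "edge e' \<delta> e"] h s by (simp add: ev_def)
qed

lemma val_hom: "is_walk G g E w \<Longrightarrow> val w \<in> hom (Ob (source w)) (Ob (terminal w))"
proof (induction w)
  case (Triv x)
  then show ?case using Ob_E by auto
next
  case (Step e \<delta> w)
  then show ?case using ev_hom[of "terminal w" e \<delta>] walk_Elems(2)[of G g E w] by auto
qed

lemma val_comp:
  assumes "is_walk G g E v"
  shows "is_walk G g E u \<Longrightarrow> source u = terminal v \<Longrightarrow> val (wcomp u v) = val u \<bullet> val v"
proof (induction u)
  case (Triv x)
  then show ?case using ident_left[OF val_hom[OF assms]] by simp
next
  case (Step e \<delta> u)
  then have "ev e \<delta> (terminal u) \<in> hom (Ob (terminal u)) (Ob e)"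
    using ev_hom[of "terminal u" e \<delta>] walk_Elems(2)[of G g E u] by simp
  moreover have "val u \<in> hom (Ob (terminal v)) (Ob (terminal u))"
    using val_hom[of u] Step.prems by simp
  ultimately show ?case
    using comp_assoc[OF _ _ val_hom[OF assms]] Step by simp
qed

section \<open>Invariance of the value under homotopy\<close>

lemma val_homotopic_local:
  assumes "\<alpha> \<in> I" "homotopic G g (F \<alpha>) u v"
  shows "val u = val v"
  using V_homotopic[OF assms] val_local[OF assms(1)]
    frac_brauer.homotopic_imp_walk[OF frac[OF assms(1)] assms(2)] by simp

lemma val_edge_Tau:
  assumes "x \<in> Elems E" "y \<in> Elems E" "Pcl E x = Pcl E y"
  shows "val (edge y Tau x) = tauval x y"
  using ident_right[OF tauval_hom[OF assms]] by (simp add: ev_def)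

text \<open>Both (h3) and (h4) say that an arrow \<open>c\<close> commutes with \<open>\<tau>\<close>; along a chain this need only
  be checked for neighbours, which lie in a common member of the family.\<close>

lemma sval_map:
  assumes R: "\<And>x y. R x y \<Longrightarrow> adj x y \<and> adj (\<phi> x) (\<phi> y) \<and> jump (\<phi> x) (\<phi> y) \<bullet> c x = c y \<bullet> jump x y"
    and c: "\<And>x. x \<in> Elems E \<Longrightarrow> \<phi> x \<in> Elems E \<and> c x \<in> hom (Ob x) (Ob (\<phi> x))"
  shows "xs \<noteq> [] \<Longrightarrow> set xs \<subseteq> Elems E \<Longrightarrow> successively R xs \<Longrightarrow>
    chain xs \<and> chain (map \<phi> xs) \<and> sval (map \<phi> xs) \<bullet> c (hd xs) = c (last xs) \<bullet> sval xs"
proof (induction xs rule: induct_list012)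
  case (2 x)
  then show ?case
    using c[of x] ident_left[of "c x" "Ob x" "Ob (\<phi> x)"] ident_right[of "c x" "Ob x" "Ob (\<phi> x)"] by simp
next
  case (3 x y zs)
  have IH: "chain (y # zs)" "chain (\<phi> y # map \<phi> zs)"
    "sval (\<phi> y # map \<phi> zs) \<bullet> c y = c (last (y # zs)) \<bullet> sval (y # zs)"
    using 3 by auto
  have xy: "adj x y" "adj (\<phi> x) (\<phi> y)" "jump (\<phi> x) (\<phi> y) \<bullet> c x = c y \<bullet> jump x y"
    using 3(5) R[of x y] by auto
  let ?z = "last (y # zs)"
  have z: "?z \<in> Elems E" using 3(4) last_in_set[of "y # zs"] by auto
  have h: "c x \<in> hom (Ob x) (Ob (\<phi> x))" "c y \<in> hom (Ob y) (Ob (\<phi> y))" "c ?z \<in> hom (Ob ?z) (Ob (\<phi> ?z))"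
    using c 3(4) z by auto
  have s1: "sval (\<phi> y # map \<phi> zs) \<in> hom (Ob (\<phi> y)) (Ob (\<phi> ?z))"
    using sval_hom[OF IH(2)] last_map[of "y # zs" \<phi>] by simp
  have s2: "sval (y # zs) \<in> hom (Ob y) (Ob ?z)" using sval_hom[OF IH(1)] by simp
  have "(sval (\<phi> y # map \<phi> zs) \<bullet> jump (\<phi> x) (\<phi> y)) \<bullet> c x = sval (\<phi> y # map \<phi> zs) \<bullet> (c y \<bullet> jump x y)"
    using comp_assoc[OF s1 jump_hom[OF xy(2)] h(1)] xy(3) by simp
  also have "\<dots> = (c ?z \<bullet> sval (y # zs)) \<bullet> jump x y"
    using comp_assoc[OF s1 h(2) jump_hom[OF xy(1)]] IH(3) by simp
  also have "\<dots> = c ?z \<bullet> (sval (y # zs) \<bullet> jump x y)"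
    using comp_assoc[OF h(3) s2 jump_hom[OF xy(1)]] .
  finally show ?case using IH xy by simp
qed simp

text \<open>Since \<open>tauval\<close> may be computed along any chain, it is computed along
  \<open>xs\<close> and its image. The relation \<open>R\<close> is a parameter because (h3) is
  checked on \<open>adj\<close>-neighbours and (h4) only on \<open>Ladj\<close>-neighbours.\<close>

lemma tauval_map:
  assumes "\<And>x y. R x y \<Longrightarrow> adj x y \<and> adj (\<phi> x) (\<phi> y) \<and> jump (\<phi> x) (\<phi> y) \<bullet> c x = c y \<bullet> jump x y"
    and "\<And>x. x \<in> Elems E \<Longrightarrow> \<phi> x \<in> Elems E \<and> c x \<in> hom (Ob x) (Ob (\<phi> x))"
    and "xs \<noteq> []" "set xs \<subseteq> Elems E" "successively R xs"
  shows "tauval (\<phi> (hd xs)) (\<phi> (last xs)) \<bullet> c (hd xs) = c (last xs) \<bullet> tauval (hd xs) (last xs)"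
proof -
  have *: "chain xs" "chain (map \<phi> xs)" "sval (map \<phi> xs) \<bullet> c (hd xs) = c (last xs) \<bullet> sval xs"
    using sval_map[of R \<phi> c xs] assms by blast+
  then show ?thesis
    using tauval_eq[OF *(1)] tauval_eq[OF *(2)] assms(3) by (simp add: hd_map last_map)
qed

text \<open>Neighbours of a P-chain satisfy (h3) inside their common member, whose degree is that of
  \<open>E\<close>; \<open>Pcl_gpow\<close> for that member shows that the translated chain is again
  a chain.\<close>

lemma val_h3:
  assumes "e \<in> Elems E" "h \<in> Elems E" "Pcl E e = Pcl E h"
  shows "tauval (gpow G g E (Deg E e) e) (gpow G g E (Deg E h) h) \<bullet> val (gwalk G g E (Deg E e) e)
    = val (gwalk G g E (Deg E h) h) \<bullet> tauval e h"
proof -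
  let ?\<phi> = "\<lambda>x. gpow G g E (Deg E x) x" and ?c = "\<lambda>x. val (gwalk G g E (Deg E x) x)"
  have c: "?\<phi> x \<in> Elems E \<and> ?c x \<in> hom (Ob x) (Ob (?\<phi> x))" if "x \<in> Elems E" for x
    using that val_hom[of "gwalk G g E (Deg E x) x"] by simp
  have R: "adj x y \<and> adj (?\<phi> x) (?\<phi> y) \<and> jump (?\<phi> x) (?\<phi> y) \<bullet> ?c x = ?c y \<bullet> jump x y"
    if xy: "adj x y" for x y
  proof -
    obtain \<alpha> where \<alpha>: "\<alpha> \<in> I" "x \<in> Elems (F \<alpha>)" "y \<in> Elems (F \<alpha>)" "Pcl (F \<alpha>) x = Pcl (F \<alpha>) y"
      using xy unfolding adj_def by blast
    interpret s: sub_frac_brauer G g E "F \<alpha>" by (rule sub_family[OF \<alpha>(1)])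
    have \<phi>: "?\<phi> z = gpow G g (F \<alpha>) (Deg (F \<alpha>) z) z"
      "gwalk G g E (Deg E z) z = gwalk G g (F \<alpha>) (Deg (F \<alpha>) z) z" if "z \<in> Elems (F \<alpha>)" for z
      using that by (simp_all only: s.sub_Act s.sub_Deg s.sub_gwalk g_facts)
    have el: "?\<phi> x \<in> Elems (F \<alpha>)" "?\<phi> y \<in> Elems (F \<alpha>)" using \<phi> \<alpha> by simp_all
    have P: "Pcl (F \<alpha>) (?\<phi> x) = Pcl (F \<alpha>) (?\<phi> y)"
      using s.K.Pcl_gpow[OF \<alpha>(2-4)] \<phi> \<alpha> by simp
    have a: "adj (?\<phi> x) (?\<phi> y)" unfolding adj_def using \<alpha>(1) el P by blast
    have E: "x \<in> Elems E" "y \<in> Elems E" "?\<phi> x \<in> Elems E" "?\<phi> y \<in> Elems E"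
      using \<alpha> c by simp_all
    have "homotopic G g (F \<alpha>)
      (wcomp (edge (?\<phi> y) Tau (?\<phi> x)) (gwalk G g E (Deg E x) x))
      (wcomp (gwalk G g E (Deg E y) y) (edge y Tau x))"
      using homotopic.h3[OF \<alpha>(2-4), of G g] \<phi>[OF \<alpha>(2)] \<phi>[OF \<alpha>(3)] by (simp only:)
    then have "val (wcomp (edge (?\<phi> y) Tau (?\<phi> x)) (gwalk G g E (Deg E x) x))
      = val (wcomp (gwalk G g E (Deg E y) y) (edge y Tau x))"
      by (rule val_homotopic_local[OF \<alpha>(1)])
    moreover have "val (wcomp (edge (?\<phi> y) Tau (?\<phi> x)) (gwalk G g E (Deg E x) x)) = tauval (?\<phi> x) (?\<phi> y) \<bullet> ?c x"
      using E by (simp add: ev_def)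
    moreover have "val (wcomp (gwalk G g E (Deg E y) y) (edge y Tau x)) = ?c y \<bullet> tauval x y"
      using E adj_Pcl[OF xy] val_comp[of "edge y Tau x" "gwalk G g E (Deg E y) y"] val_edge_Tau by simp
    ultimately show ?thesis using xy a tauval_adj by simp
  qed
  obtain xs where xs: "chain xs" "hd xs = e" "last xs = h" using chain_exists[OF assms] .
  show ?thesis
    using tauval_map[of adj ?\<phi> ?c xs] R c xs unfolding chain_def by blast
qed

text \<open>A chain of P-neighbours would not do, as \<open>g\<close> need not carry P-classes into
  P-classes. An \<open>Ladj\<close>-chain is mapped by \<open>g\<close> to an
  \<open>adj\<close>-chain, and being itself an \<open>adj\<close>-chain it still computes
  \<open>tauval\<close>.\<close>

lemma val_h4:
  assumes "e \<in> Elems E" "h \<in> Elems E" "Lcl E e = Lcl E h"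
  shows "tauval (Act E g e) (Act E g h) \<bullet> val (edge (Act E g e) Gen e)
    = val (edge (Act E g h) Gen h) \<bullet> tauval e h"
proof -
  let ?\<phi> = "Act E g" and ?c = "\<lambda>x. val (edge (Act E g x) Gen x)"
  have c: "?\<phi> x \<in> Elems E \<and> ?c x \<in> hom (Ob x) (Ob (?\<phi> x))" if "x \<in> Elems E" for x
    using that val_hom[of "edge (Act E g x) Gen x"] by simp
  have R: "adj x y \<and> adj (?\<phi> x) (?\<phi> y) \<and> jump (?\<phi> x) (?\<phi> y) \<bullet> ?c x = ?c y \<bullet> jump x y"
    if xy: "Ladj x y" for x y
  proof -
    obtain \<alpha> where \<alpha>: "\<alpha> \<in> I" "x \<in> Elems (F \<alpha>)" "y \<in> Elems (F \<alpha>)" "Lcl (F \<alpha>) x = Lcl (F \<alpha>) y"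
      using xy unfolding Ladj_def by blast
    interpret s: sub_frac_brauer G g E "F \<alpha>" by (rule sub_family[OF \<alpha>(1)])
    have \<phi>: "?\<phi> x = Act (F \<alpha>) g x" "?\<phi> y = Act (F \<alpha>) g y"
      using \<alpha> by (simp_all only: s.sub_Act g_facts)
    have el: "?\<phi> x \<in> Elems (F \<alpha>)" "?\<phi> y \<in> Elems (F \<alpha>)" using \<phi> \<alpha> by simp_all
    have P: "Pcl (F \<alpha>) (?\<phi> x) = Pcl (F \<alpha>) (?\<phi> y)"
      using s.K.Lcl_Act[OF \<alpha>(2-4)] \<phi> by simp
    have xy': "adj x y" unfolding adj_def using \<alpha>(1-3) s.K.Lcl_imp_Pcl[OF \<alpha>(2-4)] by blast
    have a: "adj (?\<phi> x) (?\<phi> y)" unfolding adj_def using \<alpha>(1) el P by blast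
    have E: "x \<in> Elems E" "y \<in> Elems E" "?\<phi> x \<in> Elems E" "?\<phi> y \<in> Elems E"
      using \<alpha> c by simp_all
    have "homotopic G g (F \<alpha>)
      (wcomp (edge (?\<phi> y) Tau (?\<phi> x)) (edge (?\<phi> x) Gen x))
      (wcomp (edge (?\<phi> y) Gen y) (edge y Tau x))"
      unfolding \<phi> by (rule homotopic.h4[OF \<alpha>(2-4)])
    then have "val (wcomp (edge (?\<phi> y) Tau (?\<phi> x)) (edge (?\<phi> x) Gen x))
      = val (wcomp (edge (?\<phi> y) Gen y) (edge y Tau x))"
      by (rule val_homotopic_local[OF \<alpha>(1)])
    moreover have "val (wcomp (edge (?\<phi> y) Tau (?\<phi> x)) (edge (?\<phi> x) Gen x)) = tauval (?\<phi> x) (?\<phi> y) \<bullet> ?c x"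
      by (simp add: ev_def)
    moreover have "val (wcomp (edge (?\<phi> y) Gen y) (edge y Tau x)) = ?c y \<bullet> tauval x y"
      using E adj_Pcl[OF xy'] val_comp[of "edge y Tau x" "edge (?\<phi> y) Gen y"] val_edge_Tau by simp
    ultimately show ?thesis using xy' a tauval_adj by simp
  qed
  obtain xs where xs: "xs \<noteq> []" "successively Ladj xs" "hd xs = e" "last xs = h"
    using Lcl_chain[OF assms] .
  have "set xs \<subseteq> Elems E"
    using xs(1,2,3) assms(1)
  proof (induction xs arbitrary: e rule: induct_list012)
    case (3 x y zs)
    then have "y \<in> Elems E" using Elems_union by (auto simp: Ladj_def)
    then show ?case using 3 by auto
  qed auto
  then show ?thesis
    using tauval_map[of Ladj ?\<phi> ?c xs] R c xs by blast
qed

text \<open>The two cancellation relations for \<open>g\<close> live in any member containing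
  \<open>e\<close>; the relations with \<tau> are settled by chains, and (h5) by
  \<open>val_comp\<close>.\<close>

lemma val_homotopic:
  assumes "homotopic G g E u v"
  shows "val u = val v"
  using assms
proof induction
  case (h1_inv_gen e)
  then obtain \<alpha> where \<alpha>: "\<alpha> \<in> I" "e \<in> Elems (F \<alpha>)" using Elems_union by blast
  show ?case
    using val_homotopic_local[OF \<alpha>(1) homotopic.h1_inv_gen[OF \<alpha>(2)]] Act_family[OF \<alpha>(1) _ \<alpha>(2)]
    by (simp only: g_facts)
next
  case (h1_gen_inv e)
  then obtain \<alpha> where \<alpha>: "\<alpha> \<in> I" "e \<in> Elems (F \<alpha>)" using Elems_union by blast
  show ?case
    using val_homotopic_local[OF \<alpha>(1) homotopic.h1_gen_inv[OF \<alpha>(2)]] Act_family[OF \<alpha>(1) _ \<alpha>(2)]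
    by (simp only: g_facts)
next
  case (h1_tau e)
  then show ?case
    using val_edge_Tau[of e e] tauval_eq[of "[e]"] by simp
next
  \<comment> \<open>The three points need not lie in a common member; concatenating chains for the
    two steps gives a chain for the composite step.\<close>
  case (h2 e0 e1 e2)
  obtain xs where xs: "chain xs" "hd xs = e0" "last xs = e1"
    using chain_exists[OF h2(1,2)] h2(4) by metis
  obtain ys where ys: "chain ys" "hd ys = e1" "last ys = e2"
    using chain_exists[OF h2(2,3)] h2(5) by metis
  have "hd (xs @ tl ys) = e0" "last (xs @ tl ys) = e2"
    using xs ys by (cases xs; cases ys; auto simp: last_append)+
  then have "tauval e0 e2 = tauval e1 e2 \<bullet> tauval e0 e1"
    using tauval_eq[OF chain_append[OF xs(1) ys(1)]] sval_append[OF xs(1) ys(1)]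
      tauval_eq[OF xs(1)] tauval_eq[OF ys(1)] xs ys by simp
  then show ?case
    using val_comp[of "edge e1 Tau e0" "edge e2 Tau e1"] val_edge_Tau h2 by simp
next
  case (h3 e h)
  have "val (wcomp (gwalk G g E (Deg E h) h) (edge h Tau e)) = val (gwalk G g E (Deg E h) h) \<bullet> tauval e h"
    using h3 val_comp[of "edge h Tau e" "gwalk G g E (Deg E h) h"] val_edge_Tau[OF h3] by simp
  then show ?case using val_h3[OF h3] h3 by (simp add: ev_def)
next
  case (h4 e h)
  have "Pcl E e = Pcl E h" using Lcl_imp_Pcl[OF h4] .
  then have "val (wcomp (edge (Act E g h) Gen h) (edge h Tau e)) = val (edge (Act E g h) Gen h) \<bullet> tauval e h"
    using h4 val_comp[of "edge h Tau e" "edge (Act E g h) Gen h"] val_edge_Tau[of e h] by simp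
  then show ?case using val_h4[OF h4] h4 by (simp add: ev_def)
next
  case (h5_left v w u)
  then show ?case
    using val_comp[of v u] val_comp[of w u] homotopic_imp_walk[OF h5_left(1)] by simp
next
  case (h5_right v w u)
  then show ?case
    using val_comp[of u v] val_comp[of u w] homotopic_imp_walk[OF h5_right(1)] by simp
qed auto

end

section \<open>The universal property\<close>

locale based_union = admissible G g E I F
  for G :: "'g monoid" and g :: 'g and E :: "('g, 'e) fbc_data"
    and I :: "'i set" and F :: "'i \<Rightarrow> ('g, 'e) fbc_data" +
  fixes A :: "'e set"
  assumes A_Elems: "A \<subseteq> Elems E"
    and A_family: "\<alpha> \<in> I \<Longrightarrow> A \<subseteq> Elems (F \<alpha>)"
    and meets: "\<alpha> \<in> I \<Longrightarrow> C \<in> connected_components G g (F \<alpha>) \<Longrightarrow> A \<inter> C \<noteq> {}"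
begin

abbreviation FGf :: "'i \<Rightarrow> ('e, 'e walk set) gpd" where
  "FGf \<alpha> \<equiv> fundamental_groupoid G g (F \<alpha>) A"

lemma walk_from_A:
  assumes "\<alpha> \<in> I" "x \<in> Elems (F \<alpha>)"
  obtains r where "is_walk G g (F \<alpha>) r" "source r \<in> A" "terminal r = x"
proof -
  let ?C = "{h. \<exists>w. is_walk G g (F \<alpha>) w \<and> source w = x \<and> terminal w = h}"
  have "?C \<in> connected_components G g (F \<alpha>)"
    unfolding connected_components_def using assms(2) by (rule imageI)
  then have "A \<inter> ?C \<noteq> {}" by (rule meets[OF assms(1)])
  then obtain w where "is_walk G g (F \<alpha>) w" "source w = x" "terminal w \<in> A" by blast
  then show thesis
    using that[of "winv w"] frac_brauer.is_walk_winv[OF frac_family[OF assms(1)]] by simp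
qed

text \<open>The condition on connected components is applied to the intersection, which is itself a
  member; applied to each member of \<open>J\<close> it would yield unrelated walks.\<close>

lemma common_walk_from_A:
  assumes "finite J" "J \<noteq> {}" "J \<subseteq> I" "\<And>\<alpha>. \<alpha> \<in> J \<Longrightarrow> x \<in> Elems (F \<alpha>)"
  shows "\<exists>r. (\<forall>\<alpha>\<in>J. is_walk G g (F \<alpha>) r) \<and> source r \<in> A \<and> terminal r = x"
proof -
  obtain \<gamma> where \<gamma>: "\<gamma> \<in> I" "Elems (F \<gamma>) = (\<Inter>\<alpha>\<in>J. Elems (F \<alpha>))"
    "\<And>\<alpha>. \<alpha> \<in> J \<Longrightarrow> sub_fbc G g (F \<gamma>) (F \<alpha>)"
    using finite_inter[OF assms(1-3)] by metis
  have "x \<in> Elems (F \<gamma>)" using \<gamma>(2) assms(4) by simp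
  then obtain r where r: "is_walk G g (F \<gamma>) r" "source r \<in> A" "terminal r = x"
    using walk_from_A[OF \<gamma>(1)] by blast
  have "is_walk G g (F \<alpha>) r" if "\<alpha> \<in> J" for \<alpha>
  proof -
    interpret s: sub_frac_brauer G g "F \<alpha>" "F \<gamma>"
      using frac_family[of \<alpha>] \<gamma>(3)[OF that] that assms(3)
      by (intro sub_frac_brauer.intro sub_frac_brauer_axioms.intro) auto
    show ?thesis using s.sub_is_walk[OF r(1)] .
  qed
  then show ?thesis using r by blast
qed

text \<open>
  The Boolean packs the two functors that are compared. With \<open>r\<close> a walk from \<open>A\<close> to the
  terminal of \<open>w\<close>, the walk \<open>r\<^sup>-\<^sup>1 w\<close> is treated by induction on \<open>w\<close>.
\<close>

lemma agree:
  fixes \<chi> :: "bool \<Rightarrow> 'e walk \<Rightarrow> 'n" and m :: "'n \<Rightarrow> 'n \<Rightarrow> 'n"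
  assumes comp: "\<And>b u v. \<lbrakk> is_walk G g E u; is_walk G g E v; source u = terminal v;
      source v \<in> A; terminal v \<in> A; terminal u \<in> A \<rbrakk> \<Longrightarrow> \<chi> b (wcomp u v) = m (\<chi> b u) (\<chi> b v)"
    and hom: "\<And>b u v. \<lbrakk> homotopic G g E u v; source u \<in> A; terminal u \<in> A \<rbrakk> \<Longrightarrow> \<chi> b u = \<chi> b v"
    and loc: "\<And>\<alpha> w. \<lbrakk> \<alpha> \<in> I; is_walk G g (F \<alpha>) w; source w \<in> A; terminal w \<in> A \<rbrakk> \<Longrightarrow>
      \<chi> True w = \<chi> False w"
    and w: "is_walk G g E w" "source w \<in> A" "terminal w \<in> A"
  shows "\<chi> True w = \<chi> False w"
proof -
  \<comment> \<open>Quantifying over all members and all \<open>q\<close> lets the induction return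
    to \<open>A\<close> through whichever member the next step requires.\<close>
  define P where "P w \<longleftrightarrow> (\<forall>\<alpha> q. \<alpha> \<in> I \<longrightarrow> is_walk G g (F \<alpha>) q \<longrightarrow> source q \<in> A \<longrightarrow>
    terminal q = terminal w \<longrightarrow> \<chi> True (wcomp (winv q) w) = \<chi> False (wcomp (winv q) w))" for w
  note up = sub_frac_brauer.sub_is_walk[OF sub_family]
  note inv = frac_brauer.is_walk_winv[OF frac_family]
  have step: "P (wcomp s w)"
    if P: "P w" and w: "is_walk G g E w" "source w \<in> A"
      and s: "\<beta> \<in> I" "is_walk G g (F \<beta>) s" "source s = terminal w" for w \<beta> s
    unfolding P_def
  proof (intro allI impI)
    fix \<alpha> q assume q: "\<alpha> \<in> I" "is_walk G g (F \<alpha>) q" "source q \<in> A" "terminal q = terminal (wcomp s w)"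
    then have tq: "terminal q = terminal s" using s by simp
    \<comment> \<open>\<open>q\<close> lies in \<open>F \<alpha>\<close> and \<open>s\<close> in
      \<open>F \<beta>\<close>; a walk in both is needed to pass from one to the other.\<close>
    obtain t where t: "is_walk G g (F \<alpha>) t" "is_walk G g (F \<beta>) t" "source t \<in> A" "terminal t = terminal s"
      using common_walk_from_A[of "{\<alpha>, \<beta>}" "terminal s"] q(1) s(1) walk_Elems(2)[OF q(2)]
        walk_Elems(2)[OF s(2)] tq by auto
    obtain r where r: "is_walk G g (F \<beta>) r" "source r \<in> A" "terminal r = terminal w"
      using walk_from_A[OF s(1) walk_Elems(1)[OF s(2)]] s(3) by metis
    note E = up[OF q(1,2)] up[OF s(1,2)] up[OF q(1) t(1)] up[OF s(1) r(1)] w(1)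
    have h1: "homotopic G g E (wcomp (winv q) (wcomp s w))
        (wcomp (wcomp (winv q) t) (wcomp (winv t) (wcomp s w)))"
      by (rule homotopic_insert) (use E tq s(3) t in simp_all)
    have h2: "homotopic G g E (wcomp (wcomp (winv t) s) w)
        (wcomp (wcomp (wcomp (winv t) s) r) (wcomp (winv r) w))"
      by (rule homotopic_insert) (use E t r s(3) in simp_all)
    \<comment> \<open>The three factors are a walk of \<open>F \<alpha>\<close>, a walk of
      \<open>F \<beta>\<close>, and the walk covered by \<open>P w\<close>; all have both ends in
      \<open>A\<close>.\<close>
    have split: "\<chi> b (wcomp (winv q) (wcomp s w)) =
        m (\<chi> b (wcomp (winv q) t)) (m (\<chi> b (wcomp (wcomp (winv t) s) r)) (\<chi> b (wcomp (winv r) w)))" for b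
    proof -
      have "\<chi> b (wcomp (winv q) (wcomp s w)) =
          \<chi> b (wcomp (wcomp (winv q) t) (wcomp (winv t) (wcomp s w)))"
        by (rule hom[OF h1]) (use q s w in simp_all)
      also have "\<dots> = m (\<chi> b (wcomp (winv q) t)) (\<chi> b (wcomp (wcomp (winv t) s) w))"
        using comp[of "wcomp (winv q) t" "wcomp (winv t) (wcomp s w)" b] E q(3) tq s(3) t w by simp
      also have "\<chi> b (wcomp (wcomp (winv t) s) w) =
          \<chi> b (wcomp (wcomp (wcomp (winv t) s) r) (wcomp (winv r) w))"
        by (rule hom[OF h2]) (use s t w in simp_all)
      also have "\<dots> = m (\<chi> b (wcomp (wcomp (winv t) s) r)) (\<chi> b (wcomp (winv r) w))"
        by (rule comp) (use E s(3) t r w in simp_all)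
      finally show ?thesis .
    qed
    have "\<chi> True (wcomp (winv q) t) = \<chi> False (wcomp (winv q) t)"
      using q tq t inv[OF q(1,2)] by (intro loc[OF q(1)]) simp_all
    moreover have "\<chi> True (wcomp (wcomp (winv t) s) r) = \<chi> False (wcomp (wcomp (winv t) s) r)"
      using s t r inv[OF s(1) t(2)] by (intro loc[OF s(1)]) simp_all
    moreover have "\<chi> True (wcomp (winv r) w) = \<chi> False (wcomp (winv r) w)"
      using P s(1) r unfolding P_def by blast
    ultimately show "\<chi> True (wcomp (winv q) (wcomp s w)) = \<chi> False (wcomp (winv q) (wcomp s w))"
      by (simp only: split)
  qed
  have P_hom: "P v" if "P u" "homotopic G g E u v" "source u \<in> A" for u v
    unfolding P_def
  proof (intro allI impI)
    fix \<alpha> q assume q: "\<alpha> \<in> I" "is_walk G g (F \<alpha>) q" "source q \<in> A" "terminal q = terminal v"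
    note uv = homotopic_imp_walk[OF that(2)]
    have "homotopic G g E (wcomp (winv q) u) (wcomp (winv q) v)"
      using that(2) up[OF q(1,2)] q(4) uv by (intro homotopic.h5_left) simp_all
    then have "\<chi> b (wcomp (winv q) u) = \<chi> b (wcomp (winv q) v)" for b
      using q uv that(3) by (intro hom) simp_all
    then show "\<chi> True (wcomp (winv q) v) = \<chi> False (wcomp (winv q) v)"
      using that(1) q uv unfolding P_def by metis
  qed
  \<comment> \<open>A \<tau>-step of \<open>E\<close> is replaced by the steps of a chain, each in
    one member; (h2) in \<open>E\<close> merges them again, and \<open>P_hom\<close> carries
    \<open>P\<close> across.\<close>
  have tau: "P (wcomp (edge (last xs) Tau (hd xs)) w)"
    if "chain xs" "P w" "is_walk G g E w" "source w \<in> A" "terminal w = hd xs" for xs w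
    using that
  proof (induction xs arbitrary: w rule: induct_list012)
    case (2 x)
    have "homotopic G g E (wcomp (edge x Tau x) w) (wcomp (Triv x) w)"
      using 2 by (intro homotopic.h5_right homotopic.h1_tau) simp_all
    from P_hom[OF _ homotopic.sym[OF this]] show ?case using 2 by simp
  next
    case (3 x y zs)
    then have xy: "adj x y" "chain (y # zs)" by simp_all
    then obtain \<alpha> where \<alpha>: "\<alpha> \<in> I" "x \<in> Elems (F \<alpha>)" "y \<in> Elems (F \<alpha>)" "Pcl (F \<alpha>) x = Pcl (F \<alpha>) y"
      unfolding adj_def by blast
    let ?w = "wcomp (edge y Tau x) w" and ?z = "last (y # zs)"
    have E: "x \<in> Elems E" "y \<in> Elems E" "Pcl E x = Pcl E y" using adj_Elems adj_Pcl xy(1) by auto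
    have "?z \<in> set (y # zs)" by (rule last_in_set) simp
    then have z: "?z \<in> Elems E" "Pcl E ?z = Pcl E y"
      using xy(2) chain_Pcl[OF xy(2), of ?z] by (auto simp: chain_def)
    have "P ?w" using 3 \<alpha> by (intro step[OF 3(4,5,6) \<alpha>(1)]) simp_all
    then have Pz: "P (wcomp (edge ?z Tau y) ?w)"
      using 3(2)[of ?w] xy(2) E 3(5,6,7) by simp
    have "homotopic G g E (wcomp (wcomp (edge ?z Tau y) (edge y Tau x)) w) (wcomp (edge ?z Tau x) w)"
      using 3 E z by (intro homotopic.h5_right homotopic.h2) simp_all
    then show ?case using P_hom[OF Pz] 3(6) by simp
  qed simp
  have "P w" if "is_walk G g E w" "source w \<in> A" for w
    using that
  proof (induction w)
    case (Triv x)
    show ?case unfolding P_def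
    proof (intro allI impI)
      fix \<alpha> q assume "\<alpha> \<in> I" "is_walk G g (F \<alpha>) q" "source q \<in> A" "terminal q = terminal (Triv x)"
      then show "\<chi> True (wcomp (winv q) (Triv x)) = \<chi> False (wcomp (winv q) (Triv x))"
        using Triv inv by (intro loc[of \<alpha>]) simp_all
    qed
  next
    case (Step e \<delta> w)
    then have w: "is_walk G g E w" "source w \<in> A" "P w" "e \<in> Elems E"
      "is_step G g E e \<delta> (terminal w)" "terminal w \<in> Elems E"
      using walk_Elems(2)[of G g E w] by simp_all
    show ?case
    proof (cases "\<delta> = Tau")
      case True
      then obtain xs where "chain xs" "hd xs = terminal w" "last xs = e"
        using chain_exists[OF w(6,4)] w(5) by auto
      then show ?thesis using tau[of xs w] w True by simp
    next
      case False
      obtain \<alpha> where \<alpha>: "\<alpha> \<in> I" "terminal w \<in> Elems (F \<alpha>)" using w(6) Elems_union by blast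
      have s: "is_step G g (F \<alpha>) e \<delta> (terminal w)"
        using is_step_family[OF \<alpha> False] w(5) by simp
      have "e \<in> Elems (F \<alpha>)"
        using frac_brauer.is_step_Elems[OF frac_family[OF \<alpha>(1)] s False \<alpha>(2)] .
      then show ?thesis
        using step[OF w(3,1,2) \<alpha>(1), of "edge e \<delta> (terminal w)"] \<alpha> s by simp
    qed
  qed
  then have Pw: "P w" using w by simp
  obtain \<alpha> where "\<alpha> \<in> I" using walk_Elems(1)[OF w(1)] Elems_union by blast
  then show ?thesis
    using Pw[unfolded P_def, rule_format, of \<alpha> "Triv (terminal w)"] A_family w by auto
qed

lemma sub_members:
  assumes "\<alpha> \<in> I" "\<beta> \<in> I" "sub_fbc G g (F \<alpha>) (F \<beta>)"
  shows "sub_frac_brauer G g (F \<beta>) (F \<alpha>)"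
  using frac_family[OF assms(2)] assms(3)
  by (intro sub_frac_brauer.intro sub_frac_brauer_axioms.intro)

lemma cocone_walk:
  assumes H: "is_cocone I (\<lambda>\<alpha> \<beta>. sub_fbc G g (F \<alpha>) (F \<beta>)) FGf
      (\<lambda>\<beta> \<alpha>. induced_functor G g (F \<beta>) (\<lambda>e. e)) H \<Phi>"
    and "\<alpha> \<in> I" "\<beta> \<in> I" "sub_fbc G g (F \<alpha>) (F \<beta>)"
  shows "is_walk G g (F \<alpha>) w \<Longrightarrow> source w \<in> A \<Longrightarrow> terminal w \<in> A \<Longrightarrow>
      snd (\<Phi> \<alpha>) (hclass G g (F \<alpha>) w) = snd (\<Phi> \<beta>) (hclass G g (F \<beta>) w)"
    and "x \<in> A \<Longrightarrow> fst (\<Phi> \<alpha>) x = fst (\<Phi> \<beta>) x"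
proof -
  interpret s: sub_frac_brauer G g "F \<beta>" "F \<alpha>" by (rule sub_members[OF assms(2-4)])
  have eq: "functor_eq (FGf \<alpha>) (\<Phi> \<alpha>) (functor_comp (\<Phi> \<beta>) (induced_functor G g (F \<beta>) (\<lambda>e. e)))"
    using H assms unfolding is_cocone_def by blast
  show "snd (\<Phi> \<alpha>) (hclass G g (F \<alpha>) w) = snd (\<Phi> \<beta>) (hclass G g (F \<beta>) w)"
    if "is_walk G g (F \<alpha>) w" "source w \<in> A" "terminal w \<in> A"
    using eq s.K.FG_ArrI[OF that] s.induced_hclass[OF that(1)]
    by (simp add: functor_eq_def functor_comp_def)
  show "fst (\<Phi> \<alpha>) x = fst (\<Phi> \<beta>) x" if "x \<in> A"
    using eq that by (simp add: functor_eq_def functor_comp_def induced_functor_def)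
qed

lemma functor_walk:
  assumes "frac_brauer G g K" "is_functor (fundamental_groupoid G g K A) H \<Phi>" "A \<subseteq> Elems K"
  shows "x \<in> A \<Longrightarrow> fst \<Phi> x \<in> Obj H"
    and "x \<in> A \<Longrightarrow> snd \<Phi> (hclass G g K (Triv x)) = Ident H (fst \<Phi> x)"
    and "is_walk G g K w \<Longrightarrow> source w \<in> A \<Longrightarrow> terminal w \<in> A \<Longrightarrow> snd \<Phi> (hclass G g K w) \<in> Arr H \<and>
      Dom H (snd \<Phi> (hclass G g K w)) = fst \<Phi> (source w) \<and> Cod H (snd \<Phi> (hclass G g K w)) = fst \<Phi> (terminal w)"
    and "is_walk G g K u \<Longrightarrow> is_walk G g K v \<Longrightarrow> source u = terminal v \<Longrightarrow>
      source v \<in> A \<Longrightarrow> terminal v \<in> A \<Longrightarrow> terminal u \<in> A \<Longrightarrow>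
      snd \<Phi> (hclass G g K (wcomp u v)) = Comp H (snd \<Phi> (hclass G g K u)) (snd \<Phi> (hclass G g K v))"
proof -
  interpret K: frac_brauer G g K by (rule assms(1))
  show "x \<in> A \<Longrightarrow> fst \<Phi> x \<in> Obj H" "x \<in> A \<Longrightarrow> snd \<Phi> (hclass G g K (Triv x)) = Ident H (fst \<Phi> x)"
    using assms(2) by (simp_all add: is_functor_def)
  show "snd \<Phi> (hclass G g K w) \<in> Arr H \<and>
      Dom H (snd \<Phi> (hclass G g K w)) = fst \<Phi> (source w) \<and> Cod H (snd \<Phi> (hclass G g K w)) = fst \<Phi> (terminal w)"
    if "is_walk G g K w" "source w \<in> A" "terminal w \<in> A"
    using assms(2) K.FG_ArrI[OF that] that(1) by (simp add: is_functor_def)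
  show "snd \<Phi> (hclass G g K (wcomp u v)) = Comp H (snd \<Phi> (hclass G g K u)) (snd \<Phi> (hclass G g K v))"
    if "is_walk G g K u" "is_walk G g K v" "source u = terminal v" "source v \<in> A" "terminal v \<in> A" "terminal u \<in> A"
  proof -
    have "hclass G g K u \<in> Arr (K.FG A)" "hclass G g K v \<in> Arr (K.FG A)"
      using that by (auto intro: K.FG_ArrI)
    moreover have "\<forall>a\<in>Arr (K.FG A). \<forall>b\<in>Arr (K.FG A). Dom (K.FG A) a = Cod (K.FG A) b \<longrightarrow>
        snd \<Phi> (Comp (K.FG A) a b) = Comp H (snd \<Phi> a) (snd \<Phi> b)"
      using assms(2) unfolding is_functor_def by (elim conjE) assumption
    ultimately have "Dom (K.FG A) (hclass G g K u) = Cod (K.FG A) (hclass G g K v) \<longrightarrow>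
        snd \<Phi> (Comp (K.FG A) (hclass G g K u) (hclass G g K v))
        = Comp H (snd \<Phi> (hclass G g K u)) (snd \<Phi> (hclass G g K v))"
      by blast
    then show ?thesis using that by simp
  qed
qed

lemma cocone_E:
  "is_cocone I (\<lambda>\<alpha> \<beta>. sub_fbc G g (F \<alpha>) (F \<beta>)) FGf
    (\<lambda>\<beta> \<alpha>. induced_functor G g (F \<beta>) (\<lambda>e. e)) (FG A) (\<lambda>\<alpha>. induced_functor G g E (\<lambda>e. e))"
  unfolding is_cocone_def
proof (intro conjI ballI impI)
  fix \<alpha> assume \<alpha>: "\<alpha> \<in> I"
  interpret s: sub_frac_brauer G g E "F \<alpha>" by (rule sub_family[OF \<alpha>])
  show "is_functor (FGf \<alpha>) (FG A) (induced_functor G g E (\<lambda>e. e))"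
    by (rule s.induced_functor_sub[OF A_family[OF \<alpha>]])
  fix \<beta> assume \<beta>: "\<beta> \<in> I" "sub_fbc G g (F \<alpha>) (F \<beta>)"
  interpret b: sub_frac_brauer G g E "F \<beta>" by (rule sub_family[OF \<beta>(1)])
  interpret ab: sub_frac_brauer G g "F \<beta>" "F \<alpha>" by (rule sub_members[OF \<alpha> \<beta>])
  have "snd (induced_functor G g E (\<lambda>e. e)) a =
      snd (induced_functor G g E (\<lambda>e. e)) (snd (induced_functor G g (F \<beta>) (\<lambda>e. e)) a)"
    if a: "a \<in> Arr (FGf \<alpha>)" for a
  proof -
    obtain w where w: "a = hclass G g (F \<alpha>) w" "is_walk G g (F \<alpha>) w"
      using a by (blast elim: s.K.FG_ArrE)
    show ?thesis
      unfolding w(1) s.induced_hclass[OF w(2)] ab.induced_hclass[OF w(2)]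
        b.induced_hclass[OF ab.sub_is_walk[OF w(2)]] ..
  qed
  then show "functor_eq (FGf \<alpha>) (induced_functor G g E (\<lambda>e. e))
      (functor_comp (induced_functor G g E (\<lambda>e. e)) (induced_functor G g (F \<beta>) (\<lambda>e. e)))"
    unfolding functor_eq_def functor_comp_def by (simp add: induced_functor_def)
qed

lemma universal:
  fixes H :: "('p, 'n) gpd"
  assumes H: "groupoid H"
    and cc: "is_cocone I (\<lambda>\<alpha> \<beta>. sub_fbc G g (F \<alpha>) (F \<beta>)) FGf
      (\<lambda>\<beta> \<alpha>. induced_functor G g (F \<beta>) (\<lambda>e. e)) H \<Phi>"
  shows "\<exists>\<Theta>. is_functor (FG A) H \<Theta> \<and>
     (\<forall>\<alpha>\<in>I. functor_eq (FGf \<alpha>) (\<Phi> \<alpha>) (functor_comp \<Theta> (induced_functor G g E (\<lambda>e. e)))) \<and>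
     (\<forall>\<Psi>. is_functor (FG A) H \<Psi> \<and>
        (\<forall>\<alpha>\<in>I. functor_eq (FGf \<alpha>) (\<Phi> \<alpha>) (functor_comp \<Psi> (induced_functor G g E (\<lambda>e. e)))) \<longrightarrow>
        functor_eq (FG A) \<Theta> \<Psi>)"
proof -
  \<comment> \<open>Any member gives the same object map on \<open>A\<close>, as shown below. If
    \<open>I\<close> is empty, then so are \<open>E\<close> and \<open>A\<close>.\<close>
  define ob where "ob = fst (\<Phi> (SOME \<alpha>. \<alpha> \<in> I))"
  define f where "f \<alpha> w = snd (\<Phi> \<alpha>) (hclass G g (F \<alpha>) w)" for \<alpha> w
  have \<Phi>: "is_functor (FGf \<alpha>) H (\<Phi> \<alpha>)" if "\<alpha> \<in> I" for \<alpha>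
    using cc that unfolding is_cocone_def by blast
  note fw = functor_walk[OF frac_family \<Phi> A_family]
  \<comment> \<open>Two members need not be comparable in the diagram; their intersection is a
    member below both, and the cocone condition is applied to its two inclusions.\<close>
  have inter: "(\<forall>x\<in>A. fst (\<Phi> \<alpha>) x = fst (\<Phi> \<beta>) x) \<and>
      (\<forall>w. is_walk G g (F \<alpha>) w \<longrightarrow> is_walk G g (F \<beta>) w \<longrightarrow> source w \<in> A \<longrightarrow> terminal w \<in> A \<longrightarrow> f \<alpha> w = f \<beta> w)"
    if \<alpha>\<beta>: "\<alpha> \<in> I" "\<beta> \<in> I" for \<alpha> \<beta>
  proof -
    obtain \<gamma> where \<gamma>: "\<gamma> \<in> I" "sub_fbc G g (F \<gamma>) (F \<alpha>)" "sub_fbc G g (F \<gamma>) (F \<beta>)"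
      "\<And>w. is_walk G g (F \<alpha>) w \<Longrightarrow> is_walk G g (F \<beta>) w \<Longrightarrow> is_walk G g (F \<gamma>) w"
    proof (rule finite_inter[of "{\<alpha>, \<beta>}"])
      show "{\<alpha>, \<beta>} \<subseteq> I" using \<alpha>\<beta> by simp
      fix \<gamma> assume \<gamma>: "\<gamma> \<in> I" "\<And>\<delta>. \<delta> \<in> {\<alpha>, \<beta>} \<Longrightarrow> sub_fbc G g (F \<gamma>) (F \<delta>)"
        "\<And>w. (\<And>\<delta>. \<delta> \<in> {\<alpha>, \<beta>} \<Longrightarrow> is_walk G g (F \<delta>) w) \<Longrightarrow> is_walk G g (F \<gamma>) w"
      show thesis
        by (rule that[OF \<gamma>(1)]) (auto intro: \<gamma>(2,3))
    qed simp_all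
    note c = cocone_walk[OF cc \<gamma>(1) \<alpha>\<beta>(1) \<gamma>(2)] cocone_walk[OF cc \<gamma>(1) \<alpha>\<beta>(2) \<gamma>(3)]
    show ?thesis
    proof (intro conjI ballI allI impI)
      show "fst (\<Phi> \<alpha>) x = fst (\<Phi> \<beta>) x" if "x \<in> A" for x
        using c(2)[OF that] c(4)[OF that] by simp
      show "f \<alpha> w = f \<beta> w"
        if "is_walk G g (F \<alpha>) w" "is_walk G g (F \<beta>) w" "source w \<in> A" "terminal w \<in> A" for w
        using c(1)[OF \<gamma>(4)[OF that(1,2)] that(3,4)] c(3)[OF \<gamma>(4)[OF that(1,2)] that(3,4)]
        unfolding f_def by simp
    qed
  qed
  have ob: "fst (\<Phi> \<alpha>) x = ob x" if "\<alpha> \<in> I" "x \<in> A" for \<alpha> x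
    unfolding ob_def using inter[OF that(1) someI[of "\<lambda>\<alpha>. \<alpha> \<in> I", OF that(1)]] that(2) by blast
  interpret gpd_arrows H by (rule gpd_arrows.intro[OF H])
  interpret admissible_functors G g E I F H A ob f
  proof (intro admissible_functors.intro local_functors.intro local_functors_axioms.intro)
    show "admissible G g E I F" by (rule admissible_axioms)
    show "gpd_arrows H" by (rule gpd_arrows_axioms)
    show "frac_brauer G g (F \<alpha>)" if "\<alpha> \<in> I" for \<alpha>
      by (rule frac_family[OF that])
    show "\<exists>r. (\<forall>\<alpha>\<in>J. is_walk G g (F \<alpha>) r) \<and> source r \<in> A \<and> terminal r = x"
      if "finite J" "J \<noteq> {}" "J \<subseteq> I" "\<And>\<alpha>. \<alpha> \<in> J \<Longrightarrow> x \<in> Elems (F \<alpha>)" for J x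
      using common_walk_from_A[OF that] .
    show "f \<alpha> w \<in> hom (ob (source w)) (ob (terminal w))"
      if "\<alpha> \<in> I" "is_walk G g (F \<alpha>) w" "source w \<in> A" "terminal w \<in> A" for \<alpha> w
      using fw(3)[OF that(1,1,1,2,3,4)] ob that unfolding f_def hom_def by simp
    show "f \<alpha> (Triv a) = Ident H (ob a)" if "\<alpha> \<in> I" "a \<in> A" for \<alpha> a
      using fw(2)[OF that(1,1,1,2)] ob that unfolding f_def by simp
    show "f \<alpha> (wcomp u v) = f \<alpha> u \<bullet> f \<alpha> v"
      if "\<alpha> \<in> I" "is_walk G g (F \<alpha>) u" "is_walk G g (F \<alpha>) v" "source u = terminal v"
        "source v \<in> A" "terminal v \<in> A" "terminal u \<in> A" for \<alpha> u v
      using fw(4)[OF that(1,1,1,2-)] unfolding f_def .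
    show "f \<alpha> u = f \<alpha> v"
      if "\<alpha> \<in> I" "homotopic G g (F \<alpha>) u v" for \<alpha> u v
      using frac_brauer.hclass_eq_iff[OF frac_family[OF that(1)]]
        frac_brauer.homotopic_imp_walk[OF frac_family[OF that(1)] that(2)] that(2)
      unfolding f_def by metis
    show "f \<alpha> w = f \<beta> w"
      if "\<alpha> \<in> I" "\<beta> \<in> I" "is_walk G g (F \<alpha>) w" "is_walk G g (F \<beta>) w" "source w \<in> A" "terminal w \<in> A" for \<alpha> \<beta> w
      using inter[OF that(1,2)] that by blast
  qed
  \<comment> \<open>The choice of a representative is harmless by
    \<open>val_homotopic\<close>.\<close>
  define \<Theta> where "\<Theta> = (ob, \<lambda>c. val (SOME w. w \<in> c))"
  have fst\<Theta>: "fst \<Theta> = ob" by (simp add: \<Theta>_def)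
  have snd\<Theta>: "snd \<Theta> (hc w) = val w" if "is_walk G g E w" for w
  proof -
    have "(SOME v. v \<in> hc w) \<in> hc w" using hclass_self[OF that] by (rule someI)
    then have "homotopic G g E w (SOME v. v \<in> hc w)" by (simp add: hclass_def)
    then show ?thesis using val_homotopic by (simp add: \<Theta>_def)
  qed
  have obH: "ob x \<in> Obj H" if "x \<in> A" for x
    using Ob_E[of x] A_Elems that Ob_A by auto
  have val_A: "val w \<in> hom (ob (source w)) (ob (terminal w))"
    if "is_walk G g E w" "source w \<in> A" "terminal w \<in> A" for w
    using val_hom[OF that(1)] that Ob_A by simp
  have "is_functor (FG A) H \<Theta>"
    unfolding is_functor_def
  proof (intro conjI ballI impI)
    show "fst \<Theta> x \<in> Obj H" if "x \<in> Obj (FG A)" for x using that obH fst\<Theta> by simp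
    show "snd \<Theta> (Ident (FG A) x) = Ident H (fst \<Theta> x)" if "x \<in> Obj (FG A)" for x
      using that A_Elems snd\<Theta>[of "Triv x"] fst\<Theta> Ob_A by auto
    fix a assume "a \<in> Arr (FG A)"
    then obtain u where u: "a = hc u" "is_walk G g E u" "source u \<in> A" "terminal u \<in> A" by blast
    then show "snd \<Theta> a \<in> Arr H" "Dom H (snd \<Theta> a) = fst \<Theta> (Dom (FG A) a)"
      "Cod H (snd \<Theta> a) = fst \<Theta> (Cod (FG A) a)"
      using snd\<Theta>[OF u(2)] val_A[OF u(2-4)] fst\<Theta> by (simp_all add: hom_def)
    fix b assume "b \<in> Arr (FG A)" "Dom (FG A) a = Cod (FG A) b"
    then obtain v where v: "b = hc v" "is_walk G g E v" "source u = terminal v" using u by auto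
    then show "snd \<Theta> (Comp (FG A) a b) = snd \<Theta> a \<bullet> snd \<Theta> b"
      using u snd\<Theta> val_comp[OF v(2) u(2) v(3)] by simp
  qed
  moreover have "functor_eq (FGf \<alpha>) (\<Phi> \<alpha>) (functor_comp \<Theta> (induced_functor G g E (\<lambda>e. e)))"
    if \<alpha>: "\<alpha> \<in> I" for \<alpha>
  proof -
    interpret s: sub_frac_brauer G g E "F \<alpha>" by (rule sub_family[OF \<alpha>])
    have "snd (\<Phi> \<alpha>) a = snd \<Theta> (snd (induced_functor G g E (\<lambda>e. e)) a)" if a: "a \<in> Arr (FGf \<alpha>)" for a
    proof -
      obtain w where w: "a = hclass G g (F \<alpha>) w" "is_walk G g (F \<alpha>) w" "source w \<in> A" "terminal w \<in> A"
        using a by (blast elim: s.K.FG_ArrE)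
      have "snd \<Theta> (snd (induced_functor G g E (\<lambda>e. e)) a) = val w"
        using w(1) s.induced_hclass[OF w(2)] snd\<Theta>[OF s.sub_is_walk[OF w(2)]] by simp
      also have "\<dots> = f \<alpha> w" using val_local[OF \<alpha> w(2)] V_A[OF \<alpha> w(2-4)] by simp
      finally show ?thesis by (simp add: w(1) f_def)
    qed
    then show ?thesis
      using ob[OF \<alpha>] fst\<Theta> unfolding functor_eq_def functor_comp_def
      by (simp add: induced_functor_def)
  qed
  moreover have "functor_eq (FG A) \<Theta> \<Psi>"
    if \<Psi>: "is_functor (FG A) H \<Psi>"
      "\<forall>\<alpha>\<in>I. functor_eq (FGf \<alpha>) (\<Phi> \<alpha>) (functor_comp \<Psi> (induced_functor G g E (\<lambda>e. e)))" for \<Psi>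
  proof -
    note \<psi> = functor_walk[OF frac_brauer_axioms \<Psi>(1) A_Elems]
    have \<psi>_local: "snd \<Psi> (hc w) = val w"
      if "\<alpha> \<in> I" "is_walk G g (F \<alpha>) w" "source w \<in> A" "terminal w \<in> A" for \<alpha> w
    proof -
      interpret s: sub_frac_brauer G g E "F \<alpha>" by (rule sub_family[OF that(1)])
      have "snd (\<Phi> \<alpha>) (hclass G g (F \<alpha>) w) = snd \<Psi> (hc w)"
        using \<Psi>(2) that(1) s.K.FG_ArrI[OF that(2-4)] s.induced_hclass[OF that(2)]
        by (simp add: functor_eq_def functor_comp_def)
      then show ?thesis using val_local[OF that(1,2)] V_A[OF that] by (simp add: f_def)
    qed
    have "val w = snd \<Psi> (hc w)" if w: "is_walk G g E w" "source w \<in> A" "terminal w \<in> A" for w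
    proof -
      have "(if True then val w else snd \<Psi> (hc w)) = (if False then val w else snd \<Psi> (hc w))"
      \<comment> \<open>\<open>True\<close> selects \<open>val\<close> and \<open>False\<close> the
        competing functor; on walks of a member both are prescribed by the cocone.\<close>
      proof (rule agree[where \<chi> = "\<lambda>b w. if b then val w else snd \<Psi> (hc w)" and m = "Comp H", OF _ _ _ w])
        show "(if b then val (wcomp u v) else snd \<Psi> (hc (wcomp u v)))
            = (if b then val u else snd \<Psi> (hc u)) \<bullet> (if b then val v else snd \<Psi> (hc v))"
          if "is_walk G g E u" "is_walk G g E v" "source u = terminal v"
            "source v \<in> A" "terminal v \<in> A" "terminal u \<in> A" for b u v
          using val_comp[OF that(2,1,3)] \<psi>(4)[OF that] by simp
        show "(if b then val u else snd \<Psi> (hc u)) = (if b then val v else snd \<Psi> (hc v))"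
          if "homotopic G g E u v" for b u v
          using val_homotopic[OF that] hclass_eq_iff[of u v] homotopic_imp_walk[OF that] that by simp
        show "(if True then val w else snd \<Psi> (hc w)) = (if False then val w else snd \<Psi> (hc w))"
          if "\<alpha> \<in> I" "is_walk G g (F \<alpha>) w" "source w \<in> A" "terminal w \<in> A" for \<alpha> w
          using \<psi>_local[OF that] by simp
      qed
      then show ?thesis by simp
    qed
    then have "snd \<Theta> a = snd \<Psi> a" if "a \<in> Arr (FG A)" for a
      using that snd\<Theta> by auto
    moreover have "fst \<Theta> x = fst \<Psi> x" if x: "x \<in> A" for x
    proof -
      obtain \<alpha> where \<alpha>: "\<alpha> \<in> I" using x A_Elems Elems_union by auto
      then have "fst (\<Phi> \<alpha>) x = fst \<Psi> x"
        using \<Psi>(2) x by (simp add: functor_eq_def functor_comp_def induced_functor_def fundamental_groupoid_def)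
      then show ?thesis using ob[OF \<alpha> x] fst\<Theta> by simp
    qed
    ultimately show ?thesis by (simp add: functor_eq_def)
  qed
  ultimately show ?thesis by blast
qed

end

theorem proposition1p8:
  fixes G :: "'g monoid" and g :: 'g
    and E :: "('g, 'e) fbc_data"
    and I :: "'i set" and F :: "'i \<Rightarrow> ('g, 'e) fbc_data"
    and A :: "'e set"
  assumes "infinite_cyclic G g"
    and "fbc G g E"
    and "admissible_union G g E I F"
    and "A \<subseteq> Elems E" and "A \<subseteq> (\<Inter>\<alpha>\<in>I. Elems (F \<alpha>))"
    and "\<And>\<alpha> C. \<alpha> \<in> I \<Longrightarrow> C \<in> connected_components G g (F \<alpha>) \<Longrightarrow> A \<inter> C \<noteq> {}"
  shows "is_direct_limit TYPE(('p, 'n) gpd) I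
           (\<lambda>\<alpha> \<beta>. sub_fbc G g (F \<alpha>) (F \<beta>))
           (\<lambda>\<alpha>. fundamental_groupoid G g (F \<alpha>) A)
           (\<lambda>\<beta> \<alpha>. induced_functor G g (F \<beta>) (\<lambda>e. e))
           (fundamental_groupoid G g E A)
           (\<lambda>\<alpha>. induced_functor G g E (\<lambda>e. e))"
proof -
  have "frac_brauer G g E"
    using assms(1,2) by (simp add: frac_brauer_def infinite_cyclic_def)
  then interpret based_union G g E I F A
    using assms(3-6)
    by (intro based_union.intro based_union_axioms.intro admissible.intro admissible_axioms.intro) auto
  show ?thesis
    unfolding is_direct_limit_def
  proof (intro conjI ballI impI allI)
    show "groupoid (FGf \<alpha>)" if "\<alpha> \<in> I" for \<alpha>
      using frac_brauer.groupoid_FG[OF frac_family[OF that] A_family[OF that]] .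
    show "is_functor (FGf \<alpha>) (FGf \<beta>) (induced_functor G g (F \<beta>) (\<lambda>e. e))"
      if "\<alpha> \<in> I" "\<beta> \<in> I" "sub_fbc G g (F \<alpha>) (F \<beta>)" for \<alpha> \<beta>
      using sub_frac_brauer.induced_functor_sub[OF sub_members[OF that] A_family[OF that(1)]] .
    show "groupoid (FG A)" by (rule groupoid_FG[OF A_Elems])
  qed (use cocone_E universal in blast)+
qed

end
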